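(* For all $k$-tuples of partitions $\boldsymbol\lambda,\boldsymbol\mu$, the family $\{\mathcal L^S_{\boldsymbol\lambda/\boldsymbol\mu}(X_n;Y_m;t)\}_{n,m\ge0}$ is supersymmetric in the $X$ and $Y$ variables: each $\mathcal L^S_{\boldsymbol\lambda/\boldsymbol\mu}(X_n;Y_m;t)$ is symmetric in $x_1,\dots,x_n$ and symmetric in $y_1,\dots,y_m$, and for $n,m\ge1$, $\mathcal L^S_{\boldsymbol\lambda/\boldsymbol\mu}(x_1,\dots,x_{n-1},r;y_1,\dots,y_{m-1},-r;t)=\mathcal L^S_{\boldsymbol\lambda/\boldsymbol\mu}(x_1,\dots,x_{n-1};y_1,\dots,y_{m-1};t)$.
   Context: Fix an integer $k\ge1$ (colours $1,\dots,k$) and an indeterminate $t$. For $\mathbf I\in\{0,1\}^k$ let $|\mathbf I|=\sum_cI_c$, and for $\mathbf I,\mathbf J\in\mathbb Z^k$ let $\varphi(\mathbf I,\mathbf J)=\sum_{1\le c<d\le k}I_cJ_d$. A vertex is a unit square whose bottom, left, top, right edges carry labels $\mathbf I,\mathbf J,\mathbf K,\mathbf L\in\{0,1\}^k$; $I_c=1$ means a path of colour $c$ uses that edge (paths move up and right). White weight: $W_x(\mathbf I,\mathbf J,\mathbf K,\mathbf L)=\mathbf 1_{\mathbf I+\mathbf J=\mathbf K+\mathbf L}\prod_c\mathbf 1_{I_c+J_c\ne2}\,x^{|\mathbf L|}t^{\varphi(\mathbf L,\mathbf I+\mathbf J)}$; purple weight: $P_x(\mathbf I,\mathbf J,\mathbf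 K,\mathbf L)=\mathbf 1_{\mathbf I+\mathbf J=\mathbf K+\mathbf L}\prod_c\mathbf 1_{K_c\ge J_c}\,x^{|\mathbf L|}t^{\varphi(\mathbf L,\mathbf K-\mathbf J)}$. For $k$-tuples of partitions $\boldsymbol\lambda,\boldsymbol\mu$, each regarded as having exactly $\ell$ parts ($\ell$ large enough), and variables $X_n,Y_m$, consider the lattice with $n+m$ rows and columns $-\ell,\dots,N$ ($N$ large): rows $1,\dots,n$ from the bottom are white with parameters $x_1,\dots,x_n$, rows $n+1,\dots,n+m$ purple with parameters $y_1,\dots,y_m$; the bottom boundary edge of column $c$ carries colour $a$ iff $c=\mu^{(a)}_j-j$ for some $j$, the top boundary edge carries colour $a$ iff $c=\lambda^{(a)}_j-j$ for some $j$, left/right boundaries empty. $\mathcal L^S_{\boldsymbol\lambda/\boldsymbol\mu}(X_n;Y_m;t)$ is the sum over labellings of internal edges of the product of the vertex weights. *)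

theory Defs
  imports Main "HOL-Library.FuncSet" "HOL-Combinatorics.Permutations"
begin

text \<open>
  The entry \<open>p j\<close> is the \<open>j\<close>-th part for \<open>j \<ge> 1\<close>; the value \<open>p 0\<close> is never used.
\<close>

definition is_partition :: "(nat \<Rightarrow> nat) \<Rightarrow> bool" where
  "is_partition p \<longleftrightarrow>
     (\<forall>i j. 1 \<le> i \<longrightarrow> i \<le> j \<longrightarrow> p j \<le> p i) \<and> finite {j. 1 \<le> j \<and> p j \<noteq> 0}"

text \<open>
  A label in \<open>{0,1}\<^sup>k\<close> is an extensional integer-valued function on the colours \<open>{1..k}\<close>;
  integer values make the differences of labels in the purple weight untruncated.
\<close>

definition labels :: "nat \<Rightarrow> (nat \<Rightarrow> int) set" where
  "labels k = {1..k} \<rightarrow>\<^sub>E {0, 1}"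

definition zero_label :: "nat \<Rightarrow> nat \<Rightarrow> int" where
  "zero_label k = (\<lambda>c\<in>{1..k}. 0)"

definition label_size :: "nat \<Rightarrow> (nat \<Rightarrow> int) \<Rightarrow> int" where
  "label_size k I = (\<Sum>c\<in>{1..k}. I c)"

definition phi :: "nat \<Rightarrow> (nat \<Rightarrow> int) \<Rightarrow> (nat \<Rightarrow> int) \<Rightarrow> int" where
  "phi k I J = (\<Sum>c\<in>{1..k}. \<Sum>d\<in>{c<..k}. I c * J d)"

text \<open>
  The arguments \<open>I J K L\<close> are the bottom, left, top and right labels. On \<open>{0,1}\<close>-valued labels all
  exponents are nonnegative whenever the indicator does not vanish, so \<open>nat\<close> loses nothing.
\<close>

definition white_weight ::
  "nat \<Rightarrow> 'a::comm_ring_1 \<Rightarrow> 'a \<Rightarrow> (nat \<Rightarrow> int) \<Rightarrow> (nat \<Rightarrow> int) \<Rightarrow> (nat \<Rightarrow> int) \<Rightarrow> (nat \<Rightarrow> int) \<Rightarrow> 'a"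
where
  "white_weight k t x I J K L =
     (if (\<forall>c\<in>{1..k}. I c + J c = K c + L c) \<and> (\<forall>c\<in>{1..k}. I c + J c \<noteq> 2)
      then x ^ nat (label_size k L) * t ^ nat (phi k L (\<lambda>c. I c + J c))
      else 0)"

definition purple_weight ::
  "nat \<Rightarrow> 'a::comm_ring_1 \<Rightarrow> 'a \<Rightarrow> (nat \<Rightarrow> int) \<Rightarrow> (nat \<Rightarrow> int) \<Rightarrow> (nat \<Rightarrow> int) \<Rightarrow> (nat \<Rightarrow> int) \<Rightarrow> 'a"
where
  "purple_weight k t x I J K L =
     (if (\<forall>c\<in>{1..k}. I c + J c = K c + L c) \<and> (\<forall>c\<in>{1..k}. K c \<ge> J c)
      then x ^ nat (label_size k L) * t ^ nat (phi k L (\<lambda>c. K c - J c))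
      else 0)"

definition boundary_label :: "nat \<Rightarrow> nat \<Rightarrow> (nat \<Rightarrow> nat \<Rightarrow> nat) \<Rightarrow> int \<Rightarrow> nat \<Rightarrow> int" where
  "boundary_label k ell lam c =
     (\<lambda>a\<in>{1..k}. if \<exists>j\<in>{1..ell}. c = int (lam a j) - int j then 1 else 0)"

text \<open>
  Edge labellings of the lattice with rows \<open>1..R\<close> and columns \<open>-ell..N\<close>. The label \<open>v (i, c)\<close> sits on
  the vertical edge of column \<open>c\<close> between rows \<open>i\<close> and \<open>i + 1\<close>; the label \<open>h (i, c)\<close> sits on the
  horizontal edge of row \<open>i\<close> to the left of column \<open>c\<close>. Boundary edges carry their prescribed labels,
  so a configuration amounts to a labelling of the internal edges. For \<open>R = 0\<close> bottom and top edges
  coincide, and a configuration exists only if the two boundary conditions agree.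
\<close>

definition configs ::
  "nat \<Rightarrow> nat \<Rightarrow> int \<Rightarrow> nat \<Rightarrow> (nat \<Rightarrow> nat \<Rightarrow> nat) \<Rightarrow> (nat \<Rightarrow> nat \<Rightarrow> nat) \<Rightarrow>
     ((nat \<times> int \<Rightarrow> nat \<Rightarrow> int) \<times> (nat \<times> int \<Rightarrow> nat \<Rightarrow> int)) set"
where
  "configs k ell N R lam mu =
     {(v, h).
        v \<in> {0..R} \<times> {- int ell..N} \<rightarrow>\<^sub>E labels k \<and>
        h \<in> {1..R} \<times> {- int ell..N + 1} \<rightarrow>\<^sub>E labels k \<and>
        (\<forall>c\<in>{- int ell..N}. v (0, c) = boundary_label k ell mu c) \<and>
        (\<forall>c\<in>{- int ell..N}. v (R, c) = boundary_label k ell lam c) \<and>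
        (\<forall>i\<in>{1..R}. h (i, - int ell) = zero_label k \<and> h (i, N + 1) = zero_label k)}"

text \<open>
  The polynomial is rendered by its values at elements of an arbitrary commutative ring; an identity
  holding for all such values, in particular for indeterminates of a polynomial ring over the
  integers, is an identity of polynomials. Only \<open>x 1, \<dots>, x n\<close> and \<open>y 1, \<dots>, y m\<close> are used.
\<close>

definition super_LLT ::
  "nat \<Rightarrow> nat \<Rightarrow> int \<Rightarrow> (nat \<Rightarrow> nat \<Rightarrow> nat) \<Rightarrow> (nat \<Rightarrow> nat \<Rightarrow> nat) \<Rightarrow> 'a::comm_ring_1 \<Rightarrow>
     nat \<Rightarrow> nat \<Rightarrow> (nat \<Rightarrow> 'a) \<Rightarrow> (nat \<Rightarrow> 'a) \<Rightarrow> 'a"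
where
  "super_LLT k ell N lam mu t n m x y =
     (\<Sum>(v, h)\<in>configs k ell N (n + m) lam mu.
        \<Prod>i\<in>{1..n + m}. \<Prod>c\<in>{- int ell..N}.
          (if i \<le> n
           then white_weight k t (x i) (v (i - 1, c)) (h (i, c)) (v (i, c)) (h (i, c + 1))
           else purple_weight k t (y (i - n)) (v (i - 1, c)) (h (i, c)) (v (i, c)) (h (i, c + 1))))"

text \<open>
  The lattice is large enough for \<open>lam\<close>: every \<open>lam a\<close> has at most \<open>ell\<close> nonzero parts, and the
  rightmost occupied boundary edge, in column \<open>lam a 1 - 1\<close>, lies within the columns \<open>-ell..N\<close>.
\<close>

definition lattice_fits :: "nat \<Rightarrow> nat \<Rightarrow> int \<Rightarrow> (nat \<Rightarrow> nat \<Rightarrow> nat) \<Rightarrow> bool" where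
  "lattice_fits k ell N lam \<longleftrightarrow>
     (\<forall>a\<in>{1..k}. (\<forall>j>ell. lam a j = 0) \<and> int (lam a 1) - 1 \<le> N)"

text \<open>
  \<open>F n m x y\<close> stands for the member of the family in the variables \<open>x 1, \<dots>, x n\<close> and
  \<open>y 1, \<dots>, y m\<close>.
\<close>

definition supersymmetric ::
  "(nat \<Rightarrow> nat \<Rightarrow> (nat \<Rightarrow> 'a::comm_ring_1) \<Rightarrow> (nat \<Rightarrow> 'a) \<Rightarrow> 'a) \<Rightarrow> bool"
where
  "supersymmetric F \<longleftrightarrow>
     (\<forall>n m x y \<pi>. \<pi> permutes {1..n} \<longrightarrow> F n m (x \<circ> \<pi>) y = F n m x y) \<and>
     (\<forall>n m x y \<pi>. \<pi> permutes {1..m} \<longrightarrow> F n m x (y \<circ> \<pi>) = F n m x y) \<and>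
     (\<forall>n m x y r. 1 \<le> n \<longrightarrow> 1 \<le> m \<longrightarrow>
        F n m (x(n := r)) (y(m := - r)) = F (n - 1) (m - 1) x y)"

end

theory Submission
  imports Defs "HOL-Library.Multiset"
begin

text \<open>
  Let \<open>W x\<close> and \<open>P y\<close> be the transfer matrices of one white and of one purple row with empty left and
  right boundary. It suffices that \<open>W x P y = P y W x\<close> and \<open>W x P (-x) = 1\<close>: inserting
  \<open>P (-x) W x = 1\<close> shows that the \<open>W\<close>'s commute with each other, likewise the \<open>P\<close>'s, so the rows may be
  permuted at will and a pair \<open>r\<close>, \<open>-r\<close> of parameters drops out.

  No R-matrix is needed for the two relations. Scan a white row below a purple row from the left, and
  let \<open>S\<close> be the charge vector of the columns passed so far, that is, bottom labels minus top labels.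
  The partial sums, as functions of the two outgoing horizontal labels \<open>J1\<close>, \<open>J2\<close>, stay proportional to
  the vector supported on \<open>J1 + J2 = S\<close> with entries \<open>x^|J1| y^|J2| t^phi(J1, S)\<close>, because in these entries
  the power of \<open>t\<close> depends linearly on the summed label and the sum factors over the colours. For purple
  below white the covector supported on \<open>J1 + J2 = S\<close> with all entries \<open>1\<close> plays the dual role. Both
  two-row sums become products over columns and colours, and they agree up to the gauge factor
  \<open>(y + x) (y + x t) ... (y + x t^(|S|-1))\<close>, which is trivial at the two ends where \<open>S = 0\<close>. If
  \<open>y = -x\<close>, this gauge factor vanishes as soon as \<open>S \<noteq> 0\<close>, which leaves only the identity. The prefixes
  \<open>wp\<close> and \<open>pw\<close> refer to white below purple and purple below white.
\<close>

section \<open>Factorisation of the vertex weights over the colours\<close>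

text \<open>For nonnegative labels, phi(L, J) is the sum over c of \<open>J c * pre L c\<close>, and
  also of \<open>L c * suf k J c\<close>. One colour meets the others only through these
  counts.\<close>

definition pre :: "(nat \<Rightarrow> int) \<Rightarrow> nat \<Rightarrow> nat" where
  "pre f c = (\<Sum>b\<in>{1..<c}. nat (f b))"

definition suf :: "nat \<Rightarrow> (nat \<Rightarrow> int) \<Rightarrow> nat \<Rightarrow> nat" where
  "suf k f c = (\<Sum>b\<in>{c<..k}. nat (f b))"

text \<open>The share of one colour in the white weight; \<open>p\<close> stands for
  \<open>pre L c\<close>, the number of smaller colours on the right edge.\<close>

definition white_local :: "'a::comm_ring_1 \<Rightarrow> 'a \<Rightarrow> nat \<Rightarrow> int \<Rightarrow> int \<Rightarrow> int \<Rightarrow> int \<Rightarrow> 'a" where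
  "white_local t x p i j m l = (if i + j = m + l \<and> i + j \<noteq> 2 then x ^ nat l * t ^ (nat (i + j) * p) else 0)"

definition purple_local :: "'a::comm_ring_1 \<Rightarrow> 'a \<Rightarrow> nat \<Rightarrow> int \<Rightarrow> int \<Rightarrow> int \<Rightarrow> int \<Rightarrow> 'a" where
  "purple_local t y p i j m l = (if i + j = m + l \<and> m \<ge> j then y ^ nat l * t ^ (nat (m - j) * p) else 0)"

lemma labels_01: "I \<in> labels k \<Longrightarrow> c \<in> {1..k} \<Longrightarrow> I c \<in> {0, 1}"
  unfolding labels_def by (auto dest: PiE_mem)

lemma labels_nonneg: "I \<in> labels k \<Longrightarrow> c \<in> {1..k} \<Longrightarrow> 0 \<le> I c"
  using labels_01 by fastforce

lemma finite_labels [simp]: "finite (labels k)"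
  unfolding labels_def by (intro finite_PiE) auto

lemma zero_label_in_labels [simp]: "zero_label k \<in> labels k"
  unfolding labels_def zero_label_def by auto

lemma labels_eqI: "I \<in> labels k \<Longrightarrow> J \<in> labels k \<Longrightarrow> (\<And>c. c \<in> {1..k} \<Longrightarrow> I c = J c) \<Longrightarrow> I = J"
  unfolding labels_def by (rule PiE_ext)

lemma sum_labels_prod:
  fixes F :: "nat \<Rightarrow> int \<Rightarrow> 'a::comm_semiring_1"
  shows "(\<Sum>J\<in>labels k. \<Prod>c=1..k. F c (J c)) = (\<Prod>c=1..k. F c 0 + F c 1)"
proof -
  have "(\<Prod>c=1..k. F c 0 + F c 1) = (\<Prod>c=1..k. \<Sum>a\<in>{0,1}. F c a)" by simp
  also have "\<dots> = (\<Sum>J\<in>labels k. \<Prod>c=1..k. F c (J c))"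
    unfolding labels_def by (rule prod_sum_PiE) auto
  finally show ?thesis ..
qed

lemma power_phi:
  fixes t :: "'a::comm_ring_1"
  assumes "\<And>c. c \<in> {1..k} \<Longrightarrow> 0 \<le> L c" "\<And>c. c \<in> {1..k} \<Longrightarrow> 0 \<le> J c"
  shows "t ^ nat (phi k L J) = (\<Prod>d=1..k. t ^ (nat (J d) * pre L d))"
proof -
  have "phi k L J = (\<Sum>c\<in>{1..k}. \<Sum>d\<in>{1..k}. if c < d then L c * J d else 0)"
    unfolding phi_def
  proof (rule sum.cong[OF refl])
    fix c assume "c \<in> {1..k}"
    then show "(\<Sum>d\<in>{c<..k}. L c * J d) = (\<Sum>d\<in>{1..k}. if c < d then L c * J d else 0)"
      by (subst sum.inter_filter [symmetric]) (auto intro!: sum.cong)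
  qed
  also have "\<dots> = (\<Sum>d\<in>{1..k}. \<Sum>c\<in>{1..k}. if c < d then L c * J d else 0)"
    by (rule sum.swap)
  also have "\<dots> = (\<Sum>d\<in>{1..k}. \<Sum>c\<in>{1..<d}. L c * J d)"
  proof (rule sum.cong[OF refl])
    fix d assume "d \<in> {1..k}"
    then show "(\<Sum>c\<in>{1..k}. if c < d then L c * J d else 0) = (\<Sum>c\<in>{1..<d}. L c * J d)"
      by (subst sum.inter_filter [symmetric]) (auto intro!: sum.cong)
  qed
  also have "\<dots> = (\<Sum>d\<in>{1..k}. int (nat (J d) * pre L d))"
    unfolding pre_def of_nat_mult of_nat_sum sum_distrib_left
    by (intro sum.cong refl) (use assms in auto)
  finally have "phi k L J = int (\<Sum>d\<in>{1..k}. nat (J d) * pre L d)"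
    by (simp only: of_nat_sum)
  then have "nat (phi k L J) = (\<Sum>d\<in>{1..k}. nat (J d) * pre L d)"
    by (simp only: nat_int)
  then show ?thesis by (simp add: power_sum)
qed

lemma power_label_size:
  fixes x :: "'a::comm_ring_1"
  assumes "L \<in> labels k"
  shows "x ^ nat (label_size k L) = (\<Prod>c=1..k. x ^ nat (L c))"
proof -
  have "label_size k L = (\<Sum>c\<in>{1..k}. int (nat (L c)))"
    unfolding label_size_def by (intro sum.cong refl) (use labels_nonneg[OF assms] in auto)
  then have "nat (label_size k L) = (\<Sum>c\<in>{1..k}. nat (L c))"
    by (simp only: of_nat_sum [symmetric] nat_int)
  then show ?thesis by (simp add: power_sum)
qed

lemma prod_if_zero:
  fixes f :: "'b \<Rightarrow> 'a::comm_semiring_1"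
  assumes "finite A"
  shows "(\<Prod>c\<in>A. if P c then f c else 0) = (if \<forall>c\<in>A. P c then \<Prod>c\<in>A. f c else 0)"
  using assms by (auto intro!: prod_zero)

lemma white_weight_eq_prod:
  fixes t x :: "'a::comm_ring_1"
  assumes "I \<in> labels k" "J \<in> labels k" "L \<in> labels k"
  shows "white_weight k t x I J M L = (\<Prod>c=1..k. white_local t x (pre L c) (I c) (J c) (M c) (L c))"
proof -
  have "t ^ nat (phi k L (\<lambda>c. I c + J c)) = (\<Prod>d=1..k. t ^ (nat (I d + J d) * pre L d))"
    by (rule power_phi) (use labels_nonneg assms in \<open>auto intro: add_nonneg_nonneg\<close>)
  then show ?thesis
    unfolding white_local_def prod_if_zero[OF finite_atLeastAtMost]
      white_weight_def power_label_size[OF assms(3)] by (auto simp: prod.distrib)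
qed

lemma purple_weight_eq_prod:
  fixes t x :: "'a::comm_ring_1"
  assumes "L \<in> labels k"
  shows "purple_weight k t x I J M L = (\<Prod>c=1..k. purple_local t x (pre L c) (I c) (J c) (M c) (L c))"
proof (cases "(\<forall>c\<in>{1..k}. I c + J c = M c + L c) \<and> (\<forall>c\<in>{1..k}. M c \<ge> J c)")
  case True
  have "t ^ nat (phi k L (\<lambda>c. M c - J c)) = (\<Prod>d=1..k. t ^ (nat (M d - J d) * pre L d))"
    by (rule power_phi) (use True labels_nonneg[OF assms] in auto)
  then show ?thesis
    using True unfolding purple_local_def prod_if_zero[OF finite_atLeastAtMost]
      purple_weight_def power_label_size[OF assms] by (simp add: prod.distrib)
next
  case False
  then show ?thesis
    unfolding purple_local_def prod_if_zero[OF finite_atLeastAtMost] purple_weight_def by auto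
qed

text \<open>Both sides are t to the power phi(J, S) for the truncated entries, collected on the left
  at the smaller colour of each pair and on the right at the larger. Only the whole products agree,
  not the factors.\<close>

lemma prod_power_suf_eq_pre:
  fixes t :: "'a::comm_ring_1"
  shows "(\<Prod>c=1..k. t ^ (nat (J c) * suf k S c)) = (\<Prod>c=1..k. t ^ (nat (S c) * pre J c))"
proof -
  have "(\<Sum>c\<in>{1..k}. nat (J c) * suf k S c)
      = (\<Sum>c\<in>{1..k}. \<Sum>d\<in>{1..k}. if c < d then nat (J c) * nat (S d) else 0)"
    unfolding suf_def sum_distrib_left
  proof (rule sum.cong[OF refl])
    fix c assume "c \<in> {1..k}"
    then show "(\<Sum>d\<in>{c<..k}. nat (J c) * nat (S d)) = (\<Sum>d\<in>{1..k}. if c < d then nat (J c) * nat (S d) else 0)"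
      by (subst sum.inter_filter [symmetric]) (auto intro!: sum.cong)
  qed
  also have "\<dots> = (\<Sum>d\<in>{1..k}. \<Sum>c\<in>{1..k}. if c < d then nat (J c) * nat (S d) else 0)"
    by (rule sum.swap)
  also have "\<dots> = (\<Sum>d\<in>{1..k}. nat (S d) * pre J d)"
    unfolding pre_def sum_distrib_left
  proof (rule sum.cong[OF refl])
    fix d assume "d \<in> {1..k}"
    then show "(\<Sum>c\<in>{1..k}. if c < d then nat (J c) * nat (S d) else 0) = (\<Sum>c\<in>{1..<d}. nat (S d) * nat (J c))"
      by (subst sum.inter_filter [symmetric]) (auto intro!: sum.cong)
  qed
  finally show ?thesis by (metis power_sum)
qed

section \<open>Exchange relations at one column\<close>

text \<open>
  For one colour at one column, \<open>s\<close> is the charge entering from the left, \<open>i\<close> and \<open>m\<close> the bottom and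
  top occupation, \<open>p\<close> the outgoing charge of the smaller colours and \<open>q\<close> the incoming charge of the
  larger ones. The two orders of rows differ only in where the factor \<open>y + x * t ^ (p + q)\<close> is
  collected: when the charge of the colour disappears (white below purple) or when it appears.
\<close>

definition common_factor :: "'a::comm_ring_1 \<Rightarrow> 'a \<Rightarrow> 'a \<Rightarrow> nat \<Rightarrow> nat \<Rightarrow> int \<Rightarrow> int \<Rightarrow> int \<Rightarrow> 'a" where
  "common_factor t x y p q s i m =
    (if s = 0 \<and> i = 0 \<and> m = 0 then 1
     else if s = 0 \<and> i = 1 \<and> m = 1 then t ^ p
     else if s = 1 \<and> i = 0 \<and> m = 0 then x * t ^ q
     else if s = 1 \<and> i = 1 \<and> m = 1 then y
     else 0)"

definition wp_factor :: "'a::comm_ring_1 \<Rightarrow> 'a \<Rightarrow> 'a \<Rightarrow> nat \<Rightarrow> nat \<Rightarrow> int \<Rightarrow> int \<Rightarrow> int \<Rightarrow> 'a" where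
  "wp_factor t x y p q s i m =
    (if s = 0 \<and> i = 1 \<and> m = 0 then 1
     else if s = 1 \<and> i = 0 \<and> m = 1 then y + x * t ^ (p + q)
     else common_factor t x y p q s i m)"

definition pw_factor :: "'a::comm_ring_1 \<Rightarrow> 'a \<Rightarrow> 'a \<Rightarrow> nat \<Rightarrow> nat \<Rightarrow> int \<Rightarrow> int \<Rightarrow> int \<Rightarrow> 'a" where
  "pw_factor t x y p q s i m =
    (if s = 0 \<and> i = 1 \<and> m = 0 then y + x * t ^ (p + q)
     else if s = 1 \<and> i = 0 \<and> m = 1 then 1
     else common_factor t x y p q s i m)"

definition wp_local :: "'a::comm_ring_1 \<Rightarrow> 'a \<Rightarrow> 'a \<Rightarrow> nat \<Rightarrow> int \<Rightarrow> int \<Rightarrow> int \<Rightarrow> 'a" where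
  "wp_local t x y q s a b = (if a + b = s \<and> s \<in> {0, 1} then x ^ nat a * y ^ nat b * t ^ (nat a * q) else 0)"

definition pw_local :: "int \<Rightarrow> int \<Rightarrow> int \<Rightarrow> 'a::comm_ring_1" where
  "pw_local s a b = (if a + b = s \<and> s \<in> {0, 1} then 1 else 0)"

text \<open>A finite check. Only \<open>s = 1\<close>, \<open>i = 0\<close>, \<open>m = 1\<close>
  admits two nonzero terms, with (a, b) equal to (1, 0) or (0, 1); they add up to
  \<open>y + x * t ^ (p1 + p2 + q)\<close>. The outgoing power of t is still collected at the larger
  colour, as a multiple of \<open>p1\<close>.\<close>

lemma wp_exchange_local:
  fixes t x y :: "'a::comm_ring_1"
  assumes "i \<in> {0, 1}" "m \<in> {0, 1}" "l1 \<in> {0, 1}" "l2 \<in> {0, 1}"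
  shows "(\<Sum>a\<in>{0,1}. \<Sum>b\<in>{0,1}. \<Sum>c\<in>{0,1}. wp_local t x y q s a b *
             white_local t x p1 i a c l1 * purple_local t y p2 c b m l2)
       = wp_factor t x y (p1 + p2) q s i m *
         (if l1 + l2 = s + i - m \<and> s + i - m \<in> {0, 1}
          then x ^ nat l1 * y ^ nat l2 * t ^ (nat (s + i - m) * p1) else 0)"
proof (cases "s \<in> {0, 1}")
  case True
  with assms show ?thesis
    by (simp only: insert_iff empty_iff simp_thms)
      (elim disjE; simp add: wp_local_def white_local_def purple_local_def wp_factor_def common_factor_def
         power_add algebra_simps)
next
  case False
  then show ?thesis
    by (simp add: wp_local_def wp_factor_def common_factor_def)
qed

text \<open>The exponents are those of \<open>pw_exchange\<close> after its rewriting: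
  \<open>p\<close> and \<open>q\<close> will involve charges only, so the outgoing labels can be
  summed separately for each colour. The case with two terms is now \<open>s = 0\<close>,
  \<open>i = 1\<close>, \<open>m = 0\<close>.\<close>

lemma pw_exchange_local:
  fixes t x y :: "'a::comm_ring_1"
  assumes "i \<in> {0, 1}" "m \<in> {0, 1}" "a \<in> {0, 1}" "b \<in> {0, 1}"
    and "s' = s + i - m"
  shows "(\<Sum>l1\<in>{0,1}. \<Sum>l2\<in>{0,1}. \<Sum>c\<in>{0,1}. pw_local s' l1 l2 * (
             if i + a = c + l1 \<and> c \<ge> a \<and> c + b = m + l2 \<and> c + b \<noteq> 2
             then y ^ nat l1 * x ^ nat l2 * t ^ (nat (i - l1) * p) * t ^ (nat l2 * q) else 0))
       = pw_factor t x y p q s i m * pw_local s a b"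
proof (cases "s' \<in> {0, 1}")
  case True
  have s: "s = s' - i + m" using assms by simp
  show ?thesis
    using True assms(1-4) unfolding s
    by (simp only: insert_iff empty_iff simp_thms)
      (elim disjE; simp add: pw_local_def pw_factor_def common_factor_def power_add algebra_simps)
next
  case False
  then have "pw_factor t x y p q s i m = 0"
    unfolding pw_factor_def common_factor_def \<open>s' = s + i - m\<close> by auto
  moreover have "pw_local s' l1 l2 = (0::'a)" for l1 l2
    using False by (simp add: pw_local_def)
  ultimately show ?thesis by simp
qed

section \<open>Exchange relations at one column for all colours together\<close>

definition wp_vec :: "nat \<Rightarrow> 'a::comm_ring_1 \<Rightarrow> 'a \<Rightarrow> 'a \<Rightarrow> (nat \<Rightarrow> int) \<Rightarrow> (nat \<Rightarrow> int) \<Rightarrow> (nat \<Rightarrow> int) \<Rightarrow> 'a" where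
  "wp_vec k t x y S J1 J2 = (\<Prod>c=1..k. wp_local t x y (suf k S c) (S c) (J1 c) (J2 c))"

definition pw_vec :: "nat \<Rightarrow> (nat \<Rightarrow> int) \<Rightarrow> (nat \<Rightarrow> int) \<Rightarrow> (nat \<Rightarrow> int) \<Rightarrow> 'a::comm_ring_1" where
  "pw_vec k S J1 J2 = (\<Prod>c=1..k. pw_local (S c) (J1 c) (J2 c))"

text \<open>The scalar picked up at a column with bottom label \<open>I\<close> and top label
  \<open>K\<close>. Smaller colours enter with their outgoing charge \<open>S + I - K\<close>,
  larger ones with their incoming charge \<open>S\<close>, as if the colours were updated one after
  another.\<close>

definition wp_coef :: "nat \<Rightarrow> 'a::comm_ring_1 \<Rightarrow> 'a \<Rightarrow> 'a \<Rightarrow> (nat \<Rightarrow> int) \<Rightarrow> (nat \<Rightarrow> int) \<Rightarrow> (nat \<Rightarrow> int) \<Rightarrow> 'a" where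
  "wp_coef k t x y S I K =
    (\<Prod>c=1..k. wp_factor t x y (pre (\<lambda>c. S c + I c - K c) c) (suf k S c) (S c) (I c) (K c))"

definition pw_coef :: "nat \<Rightarrow> 'a::comm_ring_1 \<Rightarrow> 'a \<Rightarrow> 'a \<Rightarrow> (nat \<Rightarrow> int) \<Rightarrow> (nat \<Rightarrow> int) \<Rightarrow> (nat \<Rightarrow> int) \<Rightarrow> 'a" where
  "pw_coef k t x y S I K =
    (\<Prod>c=1..k. pw_factor t x y (pre (\<lambda>c. S c + I c - K c) c) (suf k S c) (S c) (I c) (K c))"

lemma sum3_labels_prod:
  fixes G :: "nat \<Rightarrow> int \<Rightarrow> int \<Rightarrow> int \<Rightarrow> 'a::comm_semiring_1"
  shows "(\<Sum>A\<in>labels k. \<Sum>B\<in>labels k. \<Sum>C\<in>labels k. \<Prod>c=1..k. G c (A c) (B c) (C c))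
       = (\<Prod>c=1..k. \<Sum>a\<in>{0,1}. \<Sum>b\<in>{0,1}. \<Sum>m\<in>{0,1}. G c a b m)"
proof -
  have "(\<Sum>A\<in>labels k. \<Sum>B\<in>labels k. \<Sum>C\<in>labels k. \<Prod>c=1..k. G c (A c) (B c) (C c))
      = (\<Sum>A\<in>labels k. \<Sum>B\<in>labels k. \<Prod>c=1..k. \<Sum>m\<in>{0,1}. G c (A c) (B c) m)"
    by (intro sum.cong refl) (simp add: sum_labels_prod[of "\<lambda>c. G c (_ c) (_ c)", simplified])
  also have "\<dots> = (\<Sum>A\<in>labels k. \<Prod>c=1..k. \<Sum>b\<in>{0,1}. \<Sum>m\<in>{0,1}. G c (A c) b m)"
    by (intro sum.cong refl)
      (simp add: sum_labels_prod[of "\<lambda>c b. \<Sum>m\<in>{0,1}. G c (_ c) b m", simplified])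
  also have "\<dots> = (\<Prod>c=1..k. \<Sum>a\<in>{0,1}. \<Sum>b\<in>{0,1}. \<Sum>m\<in>{0,1}. G c a b m)"
    by (simp add: sum_labels_prod[of "\<lambda>c a. \<Sum>b\<in>{0,1}. \<Sum>m\<in>{0,1}. G c a b m", simplified])
  finally show ?thesis .
qed

lemma pre_add:
  assumes "\<And>b. b \<in> {1..k} \<Longrightarrow> f b + g b = h b" "\<And>b. b \<in> {1..k} \<Longrightarrow> 0 \<le> f b"
    "\<And>b. b \<in> {1..k} \<Longrightarrow> 0 \<le> g b" "c \<in> {1..k}"
  shows "pre f c + pre g c = pre h c"
  unfolding pre_def sum.distrib [symmetric]
proof (rule sum.cong[OF refl])
  fix b assume "b \<in> {1..<c}"
  then have "b \<in> {1..k}" using assms(4) by auto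
  then show "nat (f b) + nat (g b) = nat (h b)"
    using assms(1-3)[of b] by (simp add: nat_add_distrib flip: assms(1))
qed

text \<open>The incoming and internal labels can be summed colour by colour, since the exponents
  contain only the fixed labels \<open>L1\<close>, \<open>L2\<close> and the charge
  \<open>S\<close>.\<close>

lemma wp_exchange:
  fixes t x y :: "'a::comm_ring_1"
  assumes I: "I \<in> labels k" and K: "K \<in> labels k" and L1: "L1 \<in> labels k" and L2: "L2 \<in> labels k"
  shows "(\<Sum>J1\<in>labels k. \<Sum>J2\<in>labels k. \<Sum>M\<in>labels k.
            wp_vec k t x y S J1 J2 * white_weight k t x I J1 M L1 * purple_weight k t y M J2 K L2)
       = wp_coef k t x y S I K * wp_vec k t x y (\<lambda>c. S c + I c - K c) L1 L2"
    (is "?lhs = _ * wp_vec k t x y ?S' L1 L2")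
proof -
  let ?G = "\<lambda>c a b m. wp_local t x y (suf k S c) (S c) a b * white_local t x (pre L1 c) (I c) a m (L1 c)
                * purple_local t y (pre L2 c) m b (K c) (L2 c)"
  have "?lhs = (\<Sum>J1\<in>labels k. \<Sum>J2\<in>labels k. \<Sum>M\<in>labels k. \<Prod>c=1..k. ?G c (J1 c) (J2 c) (M c))"
    using I L1 L2
    by (intro sum.cong refl)
      (simp add: wp_vec_def white_weight_eq_prod purple_weight_eq_prod prod.distrib)
  also have "\<dots> = (\<Prod>c=1..k. \<Sum>a\<in>{0,1}. \<Sum>b\<in>{0,1}. \<Sum>m\<in>{0,1}. ?G c a b m)"
    by (rule sum3_labels_prod)
  also have "\<dots> = (\<Prod>c=1..k. wp_factor t x y (pre L1 c + pre L2 c) (suf k S c) (S c) (I c) (K c) *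
         (if L1 c + L2 c = ?S' c \<and> ?S' c \<in> {0, 1}
          then x ^ nat (L1 c) * y ^ nat (L2 c) * t ^ (nat (?S' c) * pre L1 c) else 0))"
    by (intro prod.cong refl wp_exchange_local labels_01[OF I] labels_01[OF K] labels_01[OF L1] labels_01[OF L2])
  also have "\<dots> = wp_coef k t x y S I K * wp_vec k t x y ?S' L1 L2"
  \<comment> \<open>On the support, \<open>pre L1 + pre L2\<close> is \<open>pre\<close> of the
    outgoing charge, so the scalar does not depend on how the charge is split between the two rows;
    off the support both sides vanish.\<close>
  proof (cases "\<forall>c\<in>{1..k}. L1 c + L2 c = ?S' c \<and> ?S' c \<in> {0, 1}")
    case True
    have "pre L1 c + pre L2 c = pre ?S' c" if "c \<in> {1..k}" for c
      by (rule pre_add[of k]) (use True that labels_nonneg[OF L1] labels_nonneg[OF L2] in auto)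
    then have "(\<Prod>c=1..k. wp_factor t x y (pre L1 c + pre L2 c) (suf k S c) (S c) (I c) (K c))
        = wp_coef k t x y S I K"
      unfolding wp_coef_def by (intro prod.cong refl) simp
    moreover have "(\<Prod>c=1..k. if L1 c + L2 c = ?S' c \<and> ?S' c \<in> {0, 1}
          then x ^ nat (L1 c) * y ^ nat (L2 c) * t ^ (nat (?S' c) * pre L1 c) else 0)
        = wp_vec k t x y ?S' L1 L2"
      using True unfolding wp_vec_def wp_local_def prod_if_zero[OF finite_atLeastAtMost]
      by (simp add: prod.distrib prod_power_suf_eq_pre[where J = L1 and S = ?S', simplified])
    ultimately show ?thesis by (simp add: prod.distrib)
  next
    case False
    then show ?thesis
      unfolding wp_vec_def wp_local_def prod.distrib prod_if_zero[OF finite_atLeastAtMost] by auto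
  qed
  finally show ?thesis .
qed

text \<open>
  In contrast to \<open>wp_exchange\<close>, which propagates a vector to the right, this propagates a covector
  to the left: the sum runs over the outgoing labels.
\<close>

lemma pw_exchange:
  fixes t x y :: "'a::comm_ring_1"
  assumes I: "I \<in> labels k" and K: "K \<in> labels k" and J1: "J1 \<in> labels k" and J2: "J2 \<in> labels k"
  shows "(\<Sum>L1\<in>labels k. \<Sum>L2\<in>labels k. \<Sum>M\<in>labels k.
            pw_vec k (\<lambda>c. S c + I c - K c) L1 L2 * purple_weight k t y I J1 M L1 * white_weight k t x M J2 K L2)
       = pw_coef k t x y S I K * pw_vec k S J1 J2"
    (is "(\<Sum>L1\<in>_. \<Sum>L2\<in>_. \<Sum>M\<in>_. ?T L1 L2 M) = _")
proof -
  let ?S' = "\<lambda>c. S c + I c - K c"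
  let ?P = "\<lambda>c a l1 l2 m b. I c + a = m + l1 \<and> m \<ge> a \<and> m + b = K c + l2 \<and> m + b \<noteq> 2"
  \<comment> \<open>The exponents in this form avoid \<open>pre L1\<close> and
    \<open>pre L2\<close>, which would couple the summed labels of different colours.\<close>
  let ?H = "\<lambda>c l1 l2 m. pw_local (?S' c) l1 l2 * (if ?P c (J1 c) l1 l2 m (J2 c)
       then y ^ nat l1 * x ^ nat l2 * t ^ (nat (I c - l1) * pre ?S' c) * t ^ (nat l2 * suf k S c) else 0)"
  have vanish: "?T L1 L2 M = 0" if L: "L1 \<in> labels k" "L2 \<in> labels k" "M \<in> labels k"
    and n: "\<not> (\<forall>c\<in>{1..k}. L1 c + L2 c = ?S' c \<and> ?S' c \<in> {0, 1} \<and> ?P c (J1 c) (L1 c) (L2 c) (M c) (J2 c))"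
    for L1 L2 M
    using n
    unfolding pw_vec_def pw_local_def white_weight_def purple_weight_def prod_if_zero[OF finite_atLeastAtMost]
    by auto
  show ?thesis
  proof (cases "\<forall>c\<in>{1..k}. J1 c + J2 c = S c")
    case False
    then have "(pw_vec k S J1 J2 :: 'a) = 0"
      unfolding pw_vec_def pw_local_def prod_if_zero[OF finite_atLeastAtMost] by auto
    moreover have "?T L1 L2 M = 0" if L: "L1 \<in> labels k" "L2 \<in> labels k" "M \<in> labels k" for L1 L2 M
    proof (rule vanish[OF that], rule notI)
      assume *: "\<forall>c\<in>{1..k}. L1 c + L2 c = ?S' c \<and> ?S' c \<in> {0, 1} \<and> ?P c (J1 c) (L1 c) (L2 c) (M c) (J2 c)"
      obtain c where c: "c \<in> {1..k}" "J1 c + J2 c \<noteq> S c" using False by blast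
      \<comment> \<open>The two vertex conservation laws and \<open>L1 + L2 = S + I - K\<close> add
        up to \<open>J1 + J2 = S\<close>.\<close>
      show False using bspec[OF * c(1)] c(2) by linarith
    qed
    ultimately show ?thesis by simp
  next
    case JS: True
    have T: "?T L1 L2 M = (\<Prod>c=1..k. ?H c (L1 c) (L2 c) (M c))"
      if L: "L1 \<in> labels k" "L2 \<in> labels k" "M \<in> labels k" for L1 L2 M
    proof (cases "\<forall>c\<in>{1..k}. L1 c + L2 c = ?S' c \<and> ?S' c \<in> {0, 1} \<and> ?P c (J1 c) (L1 c) (L2 c) (M c) (J2 c)")
      case False
      then obtain c where "c \<in> {1..k}"
        "\<not> (L1 c + L2 c = ?S' c \<and> ?S' c \<in> {0, 1} \<and> ?P c (J1 c) (L1 c) (L2 c) (M c) (J2 c))" by blast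
      then have "(\<Prod>c=1..k. ?H c (L1 c) (L2 c) (M c)) = 0"
        by (intro prod_zero finite_atLeastAtMost bexI[of _ c]) (auto simp: pw_local_def)
      with vanish[OF that False] show ?thesis by simp
    next
      case True
      have p: "pre L1 c + pre L2 c = pre ?S' c" if "c \<in> {1..k}" for c
        by (rule pre_add[of k]) (use True that labels_nonneg[OF L(1)] labels_nonneg[OF L(2)] in auto)
      \<comment> \<open>Since \<open>M + J2 = (M - J1) + S\<close>, the exponents regroup into
        \<open>M - J1\<close> times \<open>pre L1 + pre L2\<close> and a remaining
        \<open>S * pre L2\<close>.\<close>
      have e: "t ^ (nat (M c - J1 c) * pre L1 c) * t ^ (nat (M c + J2 c) * pre L2 c)
          = t ^ (nat (I c - L1 c) * pre ?S' c) * t ^ (nat (S c) * pre L2 c)" if c: "c \<in> {1..k}" for c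
      proof -
        have *: "I c - L1 c = M c - J1 c" "M c + J2 c = (M c - J1 c) + S c" "0 \<le> M c - J1 c" "0 \<le> S c"
          using bspec[OF True c] bspec[OF JS c] labels_nonneg[OF J1 c] labels_nonneg[OF J2 c] by linarith+
        then have "nat (M c + J2 c) = nat (M c - J1 c) + nat (S c)" by (simp only: nat_add_distrib)
        then show ?thesis
          unfolding *(1) p[OF c, symmetric] by (simp add: power_add algebra_simps)
      qed
      have "?T L1 L2 M = (\<Prod>c=1..k. y ^ nat (L1 c) * x ^ nat (L2 c) *
            (t ^ (nat (M c - J1 c) * pre L1 c) * t ^ (nat (M c + J2 c) * pre L2 c)))"
        unfolding pw_vec_def pw_local_def purple_weight_eq_prod[OF L(1)]
          white_weight_eq_prod[OF L(3) J2 L(2)] prod.distrib[symmetric] white_local_def purple_local_def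
      proof (intro prod.cong refl)
        fix c assume "c \<in> {1..k}"
        from bspec[OF True this] show "(if L1 c + L2 c = ?S' c \<and> ?S' c \<in> {0, 1} then 1 else 0) *
          (if I c + J1 c = M c + L1 c \<and> J1 c \<le> M c
           then y ^ nat (L1 c) * t ^ (nat (M c - J1 c) * pre L1 c) else 0) *
          (if M c + J2 c = K c + L2 c \<and> M c + J2 c \<noteq> 2
           then x ^ nat (L2 c) * t ^ (nat (M c + J2 c) * pre L2 c) else 0)
         = y ^ nat (L1 c) * x ^ nat (L2 c) *
            (t ^ (nat (M c - J1 c) * pre L1 c) * t ^ (nat (M c + J2 c) * pre L2 c))"
          by (simp add: mult_ac)
      qed
      also have "\<dots> = (\<Prod>c=1..k. y ^ nat (L1 c) * x ^ nat (L2 c) *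
            (t ^ (nat (I c - L1 c) * pre ?S' c) * t ^ (nat (S c) * pre L2 c)))"
        by (intro prod.cong refl arg_cong2[of _ _ _ _ "(*)"] e)
      \<comment> \<open>The remaining power is t^phi(L2, S); collected at the smaller colour of each
        pair, it depends on the other colours through \<open>S\<close> alone.\<close>
      also have "\<dots> = (\<Prod>c=1..k. y ^ nat (L1 c) * x ^ nat (L2 c) *
            (t ^ (nat (I c - L1 c) * pre ?S' c) * t ^ (nat (L2 c) * suf k S c)))"
        by (simp only: prod.distrib prod_power_suf_eq_pre)
      also have "\<dots> = (\<Prod>c=1..k. ?H c (L1 c) (L2 c) (M c))"
      proof (intro prod.cong refl)
        fix c assume "c \<in> {1..k}"
        from bspec[OF True this] show "y ^ nat (L1 c) * x ^ nat (L2 c) *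
            (t ^ (nat (I c - L1 c) * pre ?S' c) * t ^ (nat (L2 c) * suf k S c)) = ?H c (L1 c) (L2 c) (M c)"
          unfolding pw_local_def by (simp add: mult_ac)
      qed
      finally show ?thesis .
    qed
    have "(\<Sum>L1\<in>labels k. \<Sum>L2\<in>labels k. \<Sum>M\<in>labels k. ?T L1 L2 M)
        = (\<Sum>L1\<in>labels k. \<Sum>L2\<in>labels k. \<Sum>M\<in>labels k. \<Prod>c=1..k. ?H c (L1 c) (L2 c) (M c))"
      by (intro sum.cong refl T)
    also have "\<dots> = (\<Prod>c=1..k. \<Sum>l1\<in>{0,1}. \<Sum>l2\<in>{0,1}. \<Sum>m\<in>{0,1}. ?H c l1 l2 m)"
      by (rule sum3_labels_prod)
    also have "\<dots> = (\<Prod>c=1..k. pw_factor t x y (pre ?S' c) (suf k S c) (S c) (I c) (K c) *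
        pw_local (S c) (J1 c) (J2 c))"
      by (intro prod.cong refl pw_exchange_local labels_01[OF I] labels_01[OF K] labels_01[OF J1] labels_01[OF J2])
    finally show ?thesis unfolding pw_coef_def pw_vec_def by (simp only: prod.distrib)
  qed
qed

section \<open>The gauge factor between the two orders of rows\<close>

text \<open>
  Updating the charge colour by colour, \<open>p + q\<close> is the number of other charged colours, so the factors
  collected on appearance and on disappearance of a charge telescope against \<open>gauge\<close>.
\<close>

definition gauge :: "'a::comm_ring_1 \<Rightarrow> 'a \<Rightarrow> 'a \<Rightarrow> nat \<Rightarrow> 'a" where
  "gauge t x y n = (\<Prod>i<n. y + x * t ^ i)"

text \<open>Raising the last argument of \<open>gauge\<close> from \<open>p + q\<close> to
  \<open>p + q + 1\<close> multiplies it by \<open>y + x * t ^ (p + q)\<close>, which is what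
  \<open>pw_factor\<close> collects when a charge appears and \<open>wp_factor\<close> when one
  disappears.\<close>

lemma factor_gauge:
  fixes t x y :: "'a::comm_ring_1"
  shows "wp_factor t x y p q s i m * gauge t x y (p + nat (s + i - m) + q)
       = pw_factor t x y p q s i m * gauge t x y (p + nat s + q)"
  by (auto simp: wp_factor_def pw_factor_def common_factor_def gauge_def)

lemma coef_gauge:
  fixes t x y :: "'a::comm_ring_1"
  shows "wp_coef k t x y S I K * gauge t x y (\<Sum>c=1..k. nat (S c + I c - K c))
       = pw_coef k t x y S I K * gauge t x y (\<Sum>c=1..k. nat (S c))"
proof -
  let ?S' = "\<lambda>c. S c + I c - K c"
  let ?w = "\<lambda>c. wp_factor t x y (pre ?S' c) (suf k S c) (S c) (I c) (K c)"
  let ?p = "\<lambda>c. pw_factor t x y (pre ?S' c) (suf k S c) (S c) (I c) (K c)"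
  \<comment> \<open>In the invariant the colours up to \<open>j\<close> carry their outgoing charge
    and the others still the incoming one; \<open>pre\<close> excludes its index, hence
    \<open>Suc j\<close>.\<close>
  have "j \<le> k \<Longrightarrow> (\<Prod>c=1..j. ?w c) * gauge t x y (pre ?S' (Suc j) + suf k S j)
      = (\<Prod>c=1..j. ?p c) * gauge t x y (suf k S 0)" for j
  proof (induction j)
    case 0
    then show ?case by (simp add: pre_def)
  next
    case (Suc j)
    have "{j<..k} = insert (Suc j) {Suc j<..k}" using Suc.prems by auto
    then have s: "suf k S j = nat (S (Suc j)) + suf k S (Suc j)"
      unfolding suf_def by simp
    have p: "pre ?S' (Suc (Suc j)) = pre ?S' (Suc j) + nat (?S' (Suc j))"
      unfolding pre_def by simp
    have "(\<Prod>c=1..Suc j. ?w c) * gauge t x y (pre ?S' (Suc (Suc j)) + suf k S (Suc j))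
        = (\<Prod>c=1..j. ?w c) * (?w (Suc j) *
            gauge t x y (pre ?S' (Suc j) + nat (?S' (Suc j)) + suf k S (Suc j)))"
      by (simp add: p mult.assoc)
    also have "\<dots> = ?p (Suc j) * ((\<Prod>c=1..j. ?w c) * gauge t x y (pre ?S' (Suc j) + suf k S j))"
      unfolding factor_gauge s by (simp add: algebra_simps)
    also have "\<dots> = (\<Prod>c=1..Suc j. ?p c) * gauge t x y (suf k S 0)"
      using Suc by (simp add: algebra_simps)
    finally show ?case .
  qed
  from this[of k] show ?thesis
    unfolding wp_coef_def pw_coef_def
    by (simp add: pre_def suf_def atLeastLessThanSuc_atLeastAtMost flip: atLeastSucAtMost_greaterThanAtMost)
qed

section \<open>Two adjacent rows\<close>

type_synonym 'a vertex_weight = "(nat \<Rightarrow> int) \<Rightarrow> (nat \<Rightarrow> int) \<Rightarrow> (nat \<Rightarrow> int) \<Rightarrow> (nat \<Rightarrow> int) \<Rightarrow> 'a"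

text \<open>Partial sum over the \<open>j\<close> columns from \<open>a\<close> on, with empty left
  boundary and \<open>L\<close> on the edge leaving to the right.\<close>

primrec row :: "nat \<Rightarrow> 'a::comm_ring_1 vertex_weight \<Rightarrow> int \<Rightarrow> (int \<Rightarrow> nat \<Rightarrow> int) \<Rightarrow> (int \<Rightarrow> nat \<Rightarrow> int) \<Rightarrow>
    nat \<Rightarrow> (nat \<Rightarrow> int) \<Rightarrow> 'a" where
  "row k w a s s' 0 L = (if L = zero_label k then 1 else 0)"
| "row k w a s s' (Suc j) L =
    (\<Sum>J\<in>labels k. row k w a s s' j J * w (s (a + int j)) J (s' (a + int j)) L)"

primrec two_rows :: "nat \<Rightarrow> 'a::comm_ring_1 vertex_weight \<Rightarrow> 'a vertex_weight \<Rightarrow> int \<Rightarrow>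
    (int \<Rightarrow> nat \<Rightarrow> int) \<Rightarrow> (int \<Rightarrow> nat \<Rightarrow> int) \<Rightarrow> nat \<Rightarrow> (nat \<Rightarrow> int) \<Rightarrow> (nat \<Rightarrow> int) \<Rightarrow> 'a" where
  "two_rows k w1 w2 a s s' 0 L1 L2 = (if L1 = zero_label k \<and> L2 = zero_label k then 1 else 0)"
| "two_rows k w1 w2 a s s' (Suc j) L1 L2 =
    (\<Sum>J1\<in>labels k. \<Sum>J2\<in>labels k. \<Sum>M\<in>labels k.
       two_rows k w1 w2 a s s' j J1 J2 * w1 (s (a + int j)) J1 M L1 * w2 M J2 (s' (a + int j)) L2)"

lemma row_cong:
  assumes "\<And>c. c \<in> {a..<a + int j} \<Longrightarrow> s1 c = s2 c" "\<And>c. c \<in> {a..<a + int j} \<Longrightarrow> s1' c = s2' c"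
  shows "row k w a s1 s1' j L = row k w a s2 s2' j L"
  using assms by (induction j arbitrary: L) (auto intro!: sum.cong)

lemma sum_PiE_insert:
  fixes f :: "('b \<Rightarrow> 'c) \<Rightarrow> 'a::comm_monoid_add"
  assumes "x \<notin> A"
  shows "(\<Sum>u\<in>insert x A \<rightarrow>\<^sub>E B. f u) = (\<Sum>u\<in>A \<rightarrow>\<^sub>E B. \<Sum>b\<in>B. f (u(x := b)))"
proof -
  have "(\<Sum>u\<in>insert x A \<rightarrow>\<^sub>E B. f u) = (\<Sum>(b, u)\<in>B \<times> (A \<rightarrow>\<^sub>E B). f (u(x := b)))"
    unfolding PiE_insert_eq using assms
    by (subst sum.reindex[OF inj_combinator]) (auto simp: case_prod_unfold)
  also have "\<dots> = (\<Sum>u\<in>A \<rightarrow>\<^sub>E B. \<Sum>b\<in>B. f (u(x := b)))"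
    by (subst sum.swap) (simp add: sum.cartesian_product)
  finally show ?thesis .
qed

lemma atLeastLessThan_int_Suc: "{a..<a + int (Suc j)} = insert (a + int j) {a..<a + int j}"
  by auto

text \<open>The intermediate state \<open>u\<close> has one independent label \<open>M\<close> per
  column, so its sum can be carried out column by column. A product of two row matrices thus becomes
  a two-row recursion.\<close>

lemma sum_row_row:
  fixes w1 w2 :: "'a::comm_ring_1 vertex_weight"
  shows "(\<Sum>u\<in>{a..<a + int j} \<rightarrow>\<^sub>E labels k. row k w1 a s u j L1 * row k w2 a u s' j L2)
       = two_rows k w1 w2 a s s' j L1 L2"
proof (induction j arbitrary: L1 L2)
  case 0
  then show ?case by simp
next
  case (Suc j)
  let ?c = "a + int j" and ?U = "{a..<a + int j} \<rightarrow>\<^sub>E labels k"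
  have upd: "row k w1 a s (u(?c := M)) j J = row k w1 a s u j J"
    "row k w2 a (u(?c := M)) s' j J = row k w2 a u s' j J" for u M J
    by (auto intro!: row_cong)
  have "(\<Sum>u\<in>{a..<a + int (Suc j)} \<rightarrow>\<^sub>E labels k. row k w1 a s u (Suc j) L1 * row k w2 a u s' (Suc j) L2)
      = (\<Sum>u\<in>?U. \<Sum>M\<in>labels k.
          (\<Sum>J1\<in>labels k. row k w1 a s u j J1 * w1 (s ?c) J1 M L1) *
          (\<Sum>J2\<in>labels k. row k w2 a u s' j J2 * w2 M J2 (s' ?c) L2))"
    unfolding atLeastLessThan_int_Suc by (subst sum_PiE_insert) (auto simp: upd)
  also have "\<dots> = (\<Sum>u\<in>?U. \<Sum>M\<in>labels k. \<Sum>J1\<in>labels k. \<Sum>J2\<in>labels k.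
          row k w1 a s u j J1 * row k w2 a u s' j J2 * w1 (s ?c) J1 M L1 * w2 M J2 (s' ?c) L2)"
    unfolding sum_product by (simp add: mult_ac)
  also have "\<dots> = (\<Sum>M\<in>labels k. \<Sum>J1\<in>labels k. \<Sum>J2\<in>labels k. \<Sum>u\<in>?U.
          row k w1 a s u j J1 * row k w2 a u s' j J2 * w1 (s ?c) J1 M L1 * w2 M J2 (s' ?c) L2)"
    by (subst sum.swap, rule sum.cong[OF refl], subst sum.swap, rule sum.cong[OF refl], rule sum.swap)
  also have "\<dots> = (\<Sum>M\<in>labels k. \<Sum>J1\<in>labels k. \<Sum>J2\<in>labels k.
          two_rows k w1 w2 a s s' j J1 J2 * w1 (s ?c) J1 M L1 * w2 M J2 (s' ?c) L2)"
    unfolding sum_distrib_right [symmetric] Suc.IH ..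
  also have "\<dots> = two_rows k w1 w2 a s s' (Suc j) L1 L2"
    unfolding two_rows.simps by (subst sum.swap, rule sum.cong[OF refl], rule sum.swap)
  finally show ?case .
qed

section \<open>Charges and two-row sums\<close>

definition charge :: "int \<Rightarrow> (int \<Rightarrow> nat \<Rightarrow> int) \<Rightarrow> (int \<Rightarrow> nat \<Rightarrow> int) \<Rightarrow> nat \<Rightarrow> nat \<Rightarrow> int" where
  "charge a s s' j c = (\<Sum>i<j. s (a + int i) c - s' (a + int i) c)"

lemma charge_0: "charge a s s' 0 = (\<lambda>c. 0)"
  unfolding charge_def by simp

lemma charge_eq_0: "\<forall>i<j. s (a + int i) = s' (a + int i) \<Longrightarrow> charge a s s' j c = 0"
  unfolding charge_def by simp

lemma charge_Suc:
  "charge a s s' (Suc j) = (\<lambda>c. charge a s s' j c + s (a + int j) c - s' (a + int j) c)"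
  unfolding charge_def by (auto simp: algebra_simps)

text \<open>Labels are nonnegative, so a zero sum forces both to be empty. At charge 0 the
  propagated vector thus matches the empty boundary.\<close>

lemma wp_vec_zero:
  fixes t x y :: "'a::comm_ring_1"
  assumes "L1 \<in> labels k" "L2 \<in> labels k" "\<forall>c\<in>{1..k}. S c = 0"
  shows "wp_vec k t x y S L1 L2 = (if L1 = zero_label k \<and> L2 = zero_label k then 1 else 0)"
proof (cases "L1 = zero_label k \<and> L2 = zero_label k")
  case True
  then show ?thesis
    using assms(3) unfolding wp_vec_def by (auto simp: wp_local_def zero_label_def)
next
  case False
  have "\<exists>c\<in>{1..k}. L1 c \<noteq> 0 \<or> L2 c \<noteq> 0"
  proof (rule ccontr)
    assume "\<not> ?thesis"
    then have "L1 = zero_label k" "L2 = zero_label k"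
      using labels_eqI[OF assms(1) zero_label_in_labels] labels_eqI[OF assms(2) zero_label_in_labels]
      unfolding zero_label_def by (metis restrict_apply')+
    with False show False by blast
  qed
  then obtain c where c: "c \<in> {1..k}" "L1 c \<noteq> 0 \<or> L2 c \<noteq> 0" by blast
  have "wp_local t x y (suf k S c) (S c) (L1 c) (L2 c) = 0"
    using c(2) labels_nonneg[OF assms(1) c(1)] labels_nonneg[OF assms(2) c(1)] assms(3) c(1)
    unfolding wp_local_def by auto
  then show ?thesis
    using False c(1) unfolding wp_vec_def by (auto intro!: prod_zero)
qed

text \<open>With all parameters 1 every entry on the support is 1, so \<open>wp_vec_zero\<close>
  serves the covector as well.\<close>

lemma pw_vec_eq_wp_vec: "(pw_vec k S L1 L2 :: 'a::comm_ring_1) = wp_vec k 1 1 1 S L1 L2"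
  unfolding pw_vec_def wp_vec_def pw_local_def wp_local_def by (intro prod.cong refl) simp

context
  fixes k :: nat and t x y :: "'a::comm_ring_1" and a :: int and n :: nat
    and s s' :: "int \<Rightarrow> nat \<Rightarrow> int"
  assumes s: "\<And>c. c \<in> {a..<a + int n} \<Longrightarrow> s c \<in> labels k"
    and s': "\<And>c. c \<in> {a..<a + int n} \<Longrightarrow> s' c \<in> labels k"
begin

abbreviation "ch \<equiv> charge a s s'"

lemma two_rows_wp:
  assumes "j \<le> n" "L1 \<in> labels k" "L2 \<in> labels k"
  shows "two_rows k (white_weight k t x) (purple_weight k t y) a s s' j L1 L2
       = (\<Prod>i<j. wp_coef k t x y (ch i) (s (a + int i)) (s' (a + int i))) * wp_vec k t x y (ch j) L1 L2"
  using assms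
proof (induction j arbitrary: L1 L2)
  case 0
  then show ?case by (simp add: charge_0 wp_vec_zero)
next
  case (Suc j)
  let ?c = "a + int j"
  let ?P = "\<Prod>i<j. wp_coef k t x y (ch i) (s (a + int i)) (s' (a + int i))"
  have c: "?c \<in> {a..<a + int n}" using Suc.prems by auto
  have "two_rows k (white_weight k t x) (purple_weight k t y) a s s' (Suc j) L1 L2
      = (\<Sum>J1\<in>labels k. \<Sum>J2\<in>labels k. \<Sum>M\<in>labels k. ?P * (
          wp_vec k t x y (ch j) J1 J2 * white_weight k t x (s ?c) J1 M L1 * purple_weight k t y M J2 (s' ?c) L2))"
    unfolding two_rows.simps using Suc.prems by (intro sum.cong refl) (simp add: Suc.IH mult.assoc)
  also have "\<dots> = ?P * (wp_coef k t x y (ch j) (s ?c) (s' ?c) * wp_vec k t x y (ch (Suc j)) L1 L2)"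
    unfolding sum_distrib_left [symmetric] charge_Suc
    by (subst wp_exchange) (use s[OF c] s'[OF c] Suc.prems in auto)
  finally show ?case by (simp add: mult.assoc)
qed

text \<open>For purple below white this pairing is computed rather than the separate entries:
  \<open>pw_exchange\<close> carries the covector leftward across the last column, down to charge 0,
  where it meets the empty boundary.\<close>

lemma sum_two_rows_pw:
  assumes "j \<le> n"
  shows "(\<Sum>L1\<in>labels k. \<Sum>L2\<in>labels k. pw_vec k (ch j) L1 L2 *
            two_rows k (purple_weight k t y) (white_weight k t x) a s s' j L1 L2)
       = (\<Prod>i<j. pw_coef k t x y (ch i) (s (a + int i)) (s' (a + int i)))"
  using assms
proof (induction j)
  case 0
  have "(\<Sum>L1\<in>labels k. \<Sum>L2\<in>labels k. pw_vec k (ch 0) L1 L2 *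
            two_rows k (purple_weight k t y) (white_weight k t x) a s s' 0 L1 L2)
      = (\<Sum>L1\<in>labels k. \<Sum>L2\<in>labels k. if L1 = zero_label k \<and> L2 = zero_label k then 1 else 0)"
    by (intro sum.cong refl) (auto simp: charge_0 pw_vec_eq_wp_vec wp_vec_zero)
  also have "\<dots> = (\<Sum>L1\<in>labels k. if L1 = zero_label k then 1 else 0)"
    by (intro sum.cong refl) auto
  finally show ?case by simp
next
  case (Suc j)
  let ?c = "a + int j"
  let ?Z = "two_rows k (purple_weight k t y) (white_weight k t x) a s s'"
  let ?f = "\<lambda>J1 J2 L1 L2 M. pw_vec k (ch (Suc j)) L1 L2 * purple_weight k t y (s ?c) J1 M L1
              * white_weight k t x M J2 (s' ?c) L2"
  have c: "?c \<in> {a..<a + int n}" using Suc.prems by auto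
  have "(\<Sum>L1\<in>labels k. \<Sum>L2\<in>labels k. pw_vec k (ch (Suc j)) L1 L2 * ?Z (Suc j) L1 L2)
      = (\<Sum>L1\<in>labels k. \<Sum>L2\<in>labels k. \<Sum>J1\<in>labels k. \<Sum>J2\<in>labels k.
           ?Z j J1 J2 * (\<Sum>M\<in>labels k. ?f J1 J2 L1 L2 M))"
    unfolding two_rows.simps sum_distrib_left by (intro sum.cong refl) (simp add: mult_ac)
  also have "\<dots> = (\<Sum>L1\<in>labels k. \<Sum>J1\<in>labels k. \<Sum>L2\<in>labels k. \<Sum>J2\<in>labels k.
           ?Z j J1 J2 * (\<Sum>M\<in>labels k. ?f J1 J2 L1 L2 M))"
    by (rule sum.cong[OF refl], rule sum.swap)
  also have "\<dots> = (\<Sum>J1\<in>labels k. \<Sum>L1\<in>labels k. \<Sum>J2\<in>labels k. \<Sum>L2\<in>labels k.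
           ?Z j J1 J2 * (\<Sum>M\<in>labels k. ?f J1 J2 L1 L2 M))"
    by (rule trans[OF sum.swap], rule sum.cong[OF refl], rule sum.cong[OF refl], rule sum.swap)
  also have "\<dots> = (\<Sum>J1\<in>labels k. \<Sum>J2\<in>labels k. ?Z j J1 J2 *
           (\<Sum>L1\<in>labels k. \<Sum>L2\<in>labels k. \<Sum>M\<in>labels k. ?f J1 J2 L1 L2 M))"
    unfolding sum_distrib_left by (rule sum.cong[OF refl], rule sum.swap)
  also have "\<dots> = (\<Sum>J1\<in>labels k. \<Sum>J2\<in>labels k. ?Z j J1 J2 *
           (pw_coef k t x y (ch j) (s ?c) (s' ?c) * pw_vec k (ch j) J1 J2))"
    unfolding charge_Suc
    by (intro sum.cong refl arg_cong2[of _ _ _ _ "(*)"] pw_exchange) (use s[OF c] s'[OF c] in auto)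
  also have "\<dots> = pw_coef k t x y (ch j) (s ?c) (s' ?c) *
      (\<Sum>J1\<in>labels k. \<Sum>J2\<in>labels k. pw_vec k (ch j) J1 J2 * ?Z j J1 J2)"
    unfolding sum_distrib_left by (simp add: mult_ac)
  also have "\<dots> = (\<Prod>i<Suc j. pw_coef k t x y (ch i) (s (a + int i)) (s' (a + int i)))"
    using Suc by simp
  finally show ?case .
qed

text \<open>The pairing with \<open>pw_vec\<close> says nothing about entries outside its support;
  charge conservation at the vertices makes them vanish.\<close>

lemma two_rows_pw_conservation:
  assumes "\<not> (\<forall>c\<in>{1..k}. L1 c + L2 c = ch j c)"
  shows "two_rows k (purple_weight k t y) (white_weight k t x) a s s' j L1 L2 = 0"
  using assms
proof (induction j arbitrary: L1 L2)
  case 0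
  then show ?case by (auto simp: charge_0 zero_label_def)
next
  case (Suc j)
  obtain c where c: "c \<in> {1..k}" "L1 c + L2 c \<noteq> ch (Suc j) c" using Suc.prems by blast
  have "two_rows k (purple_weight k t y) (white_weight k t x) a s s' j J1 J2
      * purple_weight k t y (s (a + int j)) J1 M L1 * white_weight k t x M J2 (s' (a + int j)) L2 = 0" for J1 J2 M
  proof (cases "\<forall>c\<in>{1..k}. J1 c + J2 c = ch j c")
    case True
    then have "\<not> (s (a + int j) c + J1 c = M c + L1 c \<and> M c + J2 c = s' (a + int j) c + L2 c)"
      using c unfolding charge_Suc by force
    then show ?thesis using c(1) unfolding purple_weight_def white_weight_def by auto
  qed (use Suc.IH in simp)
  then show ?case by simp
qed

lemma coef_prod_gauge:
  "(\<Prod>i<j. wp_coef k t x y (ch i) (s (a + int i)) (s' (a + int i))) * gauge t x y (\<Sum>c=1..k. nat (ch j c))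
     = (\<Prod>i<j. pw_coef k t x y (ch i) (s (a + int i)) (s' (a + int i)))"
proof (induction j)
  case 0
  then show ?case by (simp add: charge_0 gauge_def)
next
  case (Suc j)
  let ?w = "\<lambda>i. wp_coef k t x y (ch i) (s (a + int i)) (s' (a + int i))"
  let ?p = "\<lambda>i. pw_coef k t x y (ch i) (s (a + int i)) (s' (a + int i))"
  have "(\<Prod>i<Suc j. ?w i) * gauge t x y (\<Sum>c=1..k. nat (ch (Suc j) c))
      = (\<Prod>i<j. ?w i) * (?w j * gauge t x y (\<Sum>c=1..k. nat (ch (Suc j) c)))"
    by (simp add: mult.assoc)
  also have "\<dots> = ?p j * ((\<Prod>i<j. ?w i) * gauge t x y (\<Sum>c=1..k. nat (ch j c)))"
    unfolding charge_Suc coef_gauge by (simp add: mult_ac)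
  also have "\<dots> = (\<Prod>i<Suc j. ?p i)"
    unfolding Suc.IH by (simp add: mult.commute)
  finally show ?case .
qed

lemma two_rows_pw_zero:
  "two_rows k (purple_weight k t y) (white_weight k t x) a s s' n (zero_label k) (zero_label k)
     = (if \<forall>c\<in>{1..k}. ch n c = 0
        then \<Prod>i<n. pw_coef k t x y (ch i) (s (a + int i)) (s' (a + int i)) else 0)"
proof (cases "\<forall>c\<in>{1..k}. ch n c = 0")
  case True
  let ?Z = "two_rows k (purple_weight k t y) (white_weight k t x) a s s' n"
  have "(\<Prod>i<n. pw_coef k t x y (ch i) (s (a + int i)) (s' (a + int i)))
      = (\<Sum>L1\<in>labels k. \<Sum>L2\<in>labels k. pw_vec k (ch n) L1 L2 * ?Z L1 L2)"
    by (rule sum_two_rows_pw [symmetric]) simp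
  \<comment> \<open>At charge 0 the covector is the indicator of two empty labels, so the pairing
    reduces to a single entry.\<close>
  also have "\<dots> = (\<Sum>L1\<in>labels k. \<Sum>L2\<in>labels k.
       if L1 = zero_label k \<and> L2 = zero_label k then ?Z (zero_label k) (zero_label k) else 0)"
    by (intro sum.cong refl) (auto simp: True pw_vec_eq_wp_vec wp_vec_zero)
  also have "\<dots> = (\<Sum>L1\<in>labels k. if L1 = zero_label k then ?Z (zero_label k) (zero_label k) else 0)"
    by (intro sum.cong refl) auto
  finally show ?thesis using True by simp
next
  case False
  have "two_rows k (purple_weight k t y) (white_weight k t x) a s s' n (zero_label k) (zero_label k) = 0"
    by (rule two_rows_pw_conservation) (use False in \<open>auto simp: zero_label_def\<close>)
  then show ?thesis unfolding if_not_P[OF False] .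
qed

lemma two_rows_commute:
  "two_rows k (white_weight k t x) (purple_weight k t y) a s s' n (zero_label k) (zero_label k)
     = two_rows k (purple_weight k t y) (white_weight k t x) a s s' n (zero_label k) (zero_label k)"
proof (cases "\<forall>c\<in>{1..k}. ch n c = 0")
  case True
  \<comment> \<open>At charge 0 the gauge is the empty product, so the two products of column
    scalars coincide.\<close>
  then show ?thesis
    using coef_prod_gauge[of n] by (simp add: two_rows_wp two_rows_pw_zero wp_vec_zero gauge_def)
next
  case False
  then have "wp_vec k t x y (ch n) (zero_label k) (zero_label k) = 0"
    unfolding wp_vec_def by (auto intro!: prod_zero simp: wp_local_def zero_label_def)
  then show ?thesis using False by (auto simp add: two_rows_wp two_rows_pw_zero)
qed

text \<open>The factor \<open>y + x\<close> of the gauge kills every product that reaches a positive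
  charge. Nonzero contributions keep the charge at 0, which forces equal labels in every column, and
  each such column contributes 1.\<close>

lemma pw_coef_prod_cancel:
  assumes "y = - x" "j \<le> n" "\<forall>c\<in>{1..k}. ch j c = 0"
  shows "(\<Prod>i<j. pw_coef k t x y (ch i) (s (a + int i)) (s' (a + int i)))
       = (if \<forall>i<j. s (a + int i) = s' (a + int i) then 1 else 0)"
  using assms(2,3)
proof (induction j)
  case 0
  then show ?case by simp
next
  case (Suc j)
  let ?c = "a + int j"
  let ?P = "\<Prod>i<j. pw_coef k t x y (ch i) (s (a + int i)) (s' (a + int i))"
  have c: "?c \<in> {a..<a + int n}" using Suc.prems by auto
  show ?case
  proof (cases "\<forall>c\<in>{1..k}. ch j c = 0")
    case True
    have eq: "s ?c = s' ?c"
      using Suc.prems(2) True unfolding charge_Suc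
      by (intro labels_eqI[OF s[OF c] s'[OF c]]) auto
    have "pw_coef k t x y (ch j) (s ?c) (s' ?c) = 1"
      unfolding pw_coef_def
    proof (intro prod.neutral ballI)
      fix d assume d: "d \<in> {1..k}"
      \<comment> \<open>Even the factor \<open>t ^ p\<close> of a path going straight up is 1,
        because \<open>p = 0\<close> without charges.\<close>
      have "pre (\<lambda>c. ch j c + s ?c c - s' ?c c) d = 0"
        unfolding pre_def eq using True d by auto
      then show "pw_factor t x y (pre (\<lambda>c. ch j c + s ?c c - s' ?c c) d) (suf k (ch j) d) (ch j d) (s ?c d) (s' ?c d) = 1"
        using labels_01[OF s'[OF c] d] True d by (auto simp: eq pw_factor_def common_factor_def)
    qed
    then show ?thesis
      using Suc.IH True Suc.prems eq by (auto simp: less_Suc_eq)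
  next
    case False
    then obtain d where d: "d \<in> {1..k}" "ch j d \<noteq> 0" by blast
    have "?P * pw_coef k t x y (ch j) (s ?c) (s' ?c) = 0"
    proof (cases "ch j d = 1")
      case True
      then have "(\<Sum>c=1..k. nat (ch j c)) \<noteq> 0"
        using d(1) by (subst sum_eq_0_iff) (auto intro!: bexI[of _ d])
      then have "gauge t x y (\<Sum>c=1..k. nat (ch j c)) = 0"
        unfolding gauge_def using \<open>y = - x\<close> by (intro prod_zero bexI[of _ 0]) (simp_all del: sum_eq_0_iff)
      then show ?thesis using coef_prod_gauge[of j] by simp
    next
      \<comment> \<open>A negative charge is lost under \<open>nat\<close> and escapes the gauge;
        here \<open>pw_factor\<close> vanishes, as for any charge other than 0 and 1.\<close>
      case False
      then have "pw_coef k t x y (ch j) (s ?c) (s' ?c) = 0"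
        unfolding pw_coef_def using d
        by (intro prod_zero bexI[of _ d]) (auto simp: pw_factor_def common_factor_def)
      then show ?thesis by simp
    qed
    moreover have "\<not> (\<forall>i<Suc j. s (a + int i) = s' (a + int i))"
      using d(2) charge_eq_0[of j s a s' d] less_Suc_eq by blast
    ultimately show ?thesis by simp
  qed
qed

lemma two_rows_pw_cancel:
  assumes "y = - x"
  shows "two_rows k (purple_weight k t y) (white_weight k t x) a s s' n (zero_label k) (zero_label k)
     = (if \<forall>i<n. s (a + int i) = s' (a + int i) then 1 else 0)"
proof (cases "\<forall>c\<in>{1..k}. ch n c = 0")
  case True
  then show ?thesis using pw_coef_prod_cancel[OF assms, of n] by (simp add: two_rows_pw_zero)
next
  case False
  then have ne: "\<not> (\<forall>i<n. s (a + int i) = s' (a + int i))"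
    using charge_eq_0[of n s a s'] by blast
  show ?thesis unfolding two_rows_pw_zero if_not_P[OF False] if_not_P[OF ne] ..
qed

end

section \<open>Partition functions as products of transfer matrices\<close>

lemma restrict_PiE_eqI: "f \<in> A \<rightarrow>\<^sub>E B \<Longrightarrow> (\<And>x. x \<in> A \<Longrightarrow> g x = f x) \<Longrightarrow> restrict g A = f"
  by (rule extensionalityI[of _ A]) (auto simp: PiE_def)

text \<open>Induction peels off the rightmost edge. The boundary conditions sit in the summand as an
  indicator, so that every edge ranges freely over \<open>labels k\<close>.\<close>

lemma row_eq_sum:
  fixes w :: "'a::comm_ring_1 vertex_weight"
  assumes "L \<in> labels k"
  shows "row k w a s s' j L =
    (\<Sum>g\<in>{a..a + int j} \<rightarrow>\<^sub>E labels k. if g a = zero_label k \<and> g (a + int j) = L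
       then \<Prod>c\<in>{a..<a + int j}. w (s c) (g c) (s' c) (g (c + 1)) else 0)"
  using assms
proof (induction j arbitrary: L)
  case 0
  have "(\<Sum>g\<in>insert a {} \<rightarrow>\<^sub>E labels k. if g a = zero_label k \<and> g a = L then 1 else 0 :: 'a)
      = (\<Sum>b\<in>labels k. if b = zero_label k \<and> b = L then 1 else 0)"
    by (subst sum_PiE_insert) auto
  also have "\<dots> = (\<Sum>b\<in>labels k. if b = zero_label k then (if L = zero_label k then 1 else 0) else 0)"
    by (intro sum.cong refl) auto
  also have "\<dots> = row k w a s s' 0 L" by simp
  finally show ?case by (simp cong: if_cong)
next
  case (Suc j)
  let ?A = "{a..a + int j}" and ?c = "a + int j" and ?d = "a + int (Suc j)"
  let ?p = "\<lambda>g. \<Prod>c\<in>{a..<?c}. w (s c) (g c) (s' c) (g (c + 1))"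
  have A: "{a..?d} = insert ?d ?A" by auto
  have "(\<Sum>g\<in>{a..?d} \<rightarrow>\<^sub>E labels k. if g a = zero_label k \<and> g ?d = L
       then \<Prod>c\<in>{a..<?d}. w (s c) (g c) (s' c) (g (c + 1)) else 0)
    = (\<Sum>g\<in>?A \<rightarrow>\<^sub>E labels k. \<Sum>b\<in>labels k.
        if b = L then (if g a = zero_label k then ?p g * w (s ?c) (g ?c) (s' ?c) L else 0) else 0)"
    unfolding A
  proof (subst sum_PiE_insert, simp, intro sum.cong refl)
    fix g b
    have "?p (g(?d := b)) = ?p g"
      by (intro prod.cong refl) auto
    then show "(if (g(?d := b)) a = zero_label k \<and> (g(?d := b)) ?d = L
       then \<Prod>c\<in>{a..<?d}. w (s c) ((g(?d := b)) c) (s' c) ((g(?d := b)) (c + 1)) else 0)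
      = (if b = L then (if g a = zero_label k then ?p g * w (s ?c) (g ?c) (s' ?c) L else 0) else 0)"
      unfolding atLeastLessThan_int_Suc by (simp add: ac_simps)
  qed
  also have "\<dots> = (\<Sum>g\<in>?A \<rightarrow>\<^sub>E labels k. if g a = zero_label k then ?p g * w (s ?c) (g ?c) (s' ?c) L else 0)"
    using Suc.prems by simp
  also have "\<dots> = (\<Sum>g\<in>?A \<rightarrow>\<^sub>E labels k. \<Sum>J\<in>labels k. if g ?c = J
      then (if g a = zero_label k then ?p g * w (s ?c) (g ?c) (s' ?c) L else 0) else 0)"
    by (intro sum.cong refl) (auto dest: PiE_mem)
  also have "\<dots> = (\<Sum>J\<in>labels k. \<Sum>g\<in>?A \<rightarrow>\<^sub>E labels k.
      (if g a = zero_label k \<and> g ?c = J then ?p g else 0) * w (s ?c) J (s' ?c) L)"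
    by (subst sum.swap) (intro sum.cong refl, auto)
  also have "\<dots> = row k w a s s' (Suc j) L"
    unfolding row.simps sum_distrib_right [symmetric] by (intro sum.cong refl) (simp add: Suc.IH)
  finally show ?case ..
qed

definition transfer :: "nat \<Rightarrow> int \<Rightarrow> nat \<Rightarrow> 'a::comm_ring_1 vertex_weight \<Rightarrow>
    (int \<Rightarrow> nat \<Rightarrow> int) \<Rightarrow> (int \<Rightarrow> nat \<Rightarrow> int) \<Rightarrow> 'a" where
  "transfer k a n w s s' = row k w a s s' n (zero_label k)"

abbreviation states :: "nat \<Rightarrow> int \<Rightarrow> nat \<Rightarrow> (int \<Rightarrow> nat \<Rightarrow> int) set" where
  "states k a n \<equiv> {a..<a + int n} \<rightarrow>\<^sub>E labels k"

abbreviation row_labellings :: "nat \<Rightarrow> int \<Rightarrow> nat \<Rightarrow> (int \<Rightarrow> nat \<Rightarrow> int) set" where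
  "row_labellings k a n \<equiv>
     {g \<in> {a..a + int n} \<rightarrow>\<^sub>E labels k. g a = zero_label k \<and> g (a + int n) = zero_label k}"

lemma transfer_eq_sum:
  "transfer k a n w s s' =
    (\<Sum>g\<in>row_labellings k a n. \<Prod>c\<in>{a..<a + int n}. w (s c) (g c) (s' c) (g (c + 1)))"
  unfolding transfer_def row_eq_sum[OF zero_label_in_labels]
  by (subst sum.inter_filter [symmetric]) (auto intro!: finite_PiE)

text \<open>Generalises \<open>configs\<close> to arbitrary boundary states, which the induction on
  the number of rows has to pass through.\<close>

definition configurations ::
  "nat \<Rightarrow> int \<Rightarrow> nat \<Rightarrow> nat \<Rightarrow> (int \<Rightarrow> nat \<Rightarrow> int) \<Rightarrow> (int \<Rightarrow> nat \<Rightarrow> int) \<Rightarrow>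
     ((nat \<times> int \<Rightarrow> nat \<Rightarrow> int) \<times> (nat \<times> int \<Rightarrow> nat \<Rightarrow> int)) set"
where
  "configurations k a n R s s' =
     {(v, h).
        v \<in> {0..R} \<times> {a..<a + int n} \<rightarrow>\<^sub>E labels k \<and>
        h \<in> {1..R} \<times> {a..a + int n} \<rightarrow>\<^sub>E labels k \<and>
        (\<forall>c\<in>{a..<a + int n}. v (0, c) = s c) \<and>
        (\<forall>c\<in>{a..<a + int n}. v (R, c) = s' c) \<and>
        (\<forall>i\<in>{1..R}. h (i, a) = zero_label k \<and> h (i, a + int n) = zero_label k)}"

definition partition_function :: "nat \<Rightarrow> int \<Rightarrow> nat \<Rightarrow> (nat \<Rightarrow> 'a::comm_ring_1 vertex_weight) \<Rightarrow> nat \<Rightarrow>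
    (int \<Rightarrow> nat \<Rightarrow> int) \<Rightarrow> (int \<Rightarrow> nat \<Rightarrow> int) \<Rightarrow> 'a" where
  "partition_function k a n w R s s' =
    (\<Sum>(v, h)\<in>configurations k a n R s s'. \<Prod>i\<in>{1..R}. \<Prod>c\<in>{a..<a + int n}.
       w i (v (i - 1, c)) (h (i, c)) (v (i, c)) (h (i, c + 1)))"

lemma finite_states: "finite (states k a n)"
  by (intro finite_PiE) auto

lemma finite_row_labellings: "finite (row_labellings k a n)"
  by (rule finite_subset[of _ "{a..a + int n} \<rightarrow>\<^sub>E labels k"]) (auto intro!: finite_PiE)

lemma finite_configurations: "finite (configurations k a n R s s')"
proof (rule finite_subset)
  show "configurations k a n R s s' \<subseteq>
      ({0..R} \<times> {a..<a + int n} \<rightarrow>\<^sub>E labels k) \<times> ({1..R} \<times> {a..a + int n} \<rightarrow>\<^sub>E labels k)"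
    unfolding configurations_def by auto
qed (intro finite_cartesian_product finite_PiE; auto)

lemma partition_function_0:
  assumes "s \<in> states k a n" "s' \<in> states k a n"
  shows "partition_function k a n w 0 s s' = (if s' = s then 1 else 0)"
proof (cases "s' = s")
  case True
  have "configurations k a n 0 s s' = {(\<lambda>(i, c)\<in>{0} \<times> {a..<a + int n}. s c, \<lambda>_. undefined)}"
  proof (intro equalityI subsetI)
    fix vh assume "vh \<in> configurations k a n 0 s s'"
    then obtain v h where vh: "vh = (v, h)" "v \<in> {0} \<times> {a..<a + int n} \<rightarrow>\<^sub>E labels k"
      "h \<in> {} \<rightarrow>\<^sub>E labels k" "\<forall>c\<in>{a..<a + int n}. v (0, c) = s c"
      unfolding configurations_def by auto
    have "(\<lambda>(i, c)\<in>{0} \<times> {a..<a + int n}. s c) = v"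
      using vh(4) by (intro restrict_PiE_eqI[OF vh(2)]) auto
    then show "vh \<in> {(\<lambda>(i, c)\<in>{0} \<times> {a..<a + int n}. s c, \<lambda>_. undefined)}"
      using vh(1,3) by auto
  qed (use assms True in \<open>auto simp: configurations_def dest: PiE_mem\<close>)
  then show ?thesis using True unfolding partition_function_def by simp
next
  case False
  have "configurations k a n 0 s s' = {}"
  proof (rule ccontr)
    assume "configurations k a n 0 s s' \<noteq> {}"
    then have "s' c = s c" if "c \<in> {a..<a + int n}" for c
      using that unfolding configurations_def by fastforce
    then show False using False PiE_ext[OF assms(2,1)] by blast
  qed
  then show ?thesis using False unfolding partition_function_def by simp
qed

text \<open>Cutting below the top row: a configuration amounts to a state \<open>u\<close> on the
  cut, a configuration of the lower \<open>R\<close> rows ending in \<open>u\<close>, and horizontal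
  labels \<open>g\<close> for the top row.\<close>

lemma partition_function_Suc:
  fixes w :: "nat \<Rightarrow> 'a::comm_ring_1 vertex_weight"
  assumes s': "s' \<in> states k a n"
  shows "partition_function k a n w (Suc R) s s' =
    (\<Sum>u\<in>states k a n. partition_function k a n w R s u * transfer k a n (w (Suc R)) u s')"
proof -
  let ?C = "{a..<a + int n}" and ?D = "{a..a + int n}" and ?X = "states k a n" and ?G = "row_labellings k a n"
  let ?wt = "\<lambda>v h i. \<Prod>c\<in>?C. w i (v (i - 1, c)) (h (i, c)) (v (i, c)) (h (i, c + 1))"
  let ?ext_v = "\<lambda>v (i, c). if i = Suc R \<and> c \<in> ?C then s' c else v (i, c)"
  let ?ext_h = "\<lambda>g h (i, c). if i = Suc R \<and> c \<in> ?D then g c else h (i, c)"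
  let ?S = "SIGMA u:?X. configurations k a n R s u \<times> ?G"
  have "(\<Sum>u\<in>?X. partition_function k a n w R s u * transfer k a n (w (Suc R)) u s')
      = (\<Sum>u\<in>?X. \<Sum>p\<in>configurations k a n R s u \<times> ?G. case p of ((v, h), g) \<Rightarrow>
          (\<Prod>i\<in>{1..R}. ?wt v h i) * (\<Prod>c\<in>?C. w (Suc R) (u c) (g c) (s' c) (g (c + 1))))"
    unfolding partition_function_def transfer_eq_sum sum_product sum.cartesian_product
    by (intro sum.cong refl) auto
  also have "\<dots> = (\<Sum>(u, (v, h), g)\<in>?S.
          (\<Prod>i\<in>{1..R}. ?wt v h i) * (\<Prod>c\<in>?C. w (Suc R) (u c) (g c) (s' c) (g (c + 1))))"
    by (subst sum.Sigma)
      (auto intro!: finite_configurations finite_cartesian_product finite_states finite_row_labellings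
        simp: case_prod_unfold)
  also have "\<dots> = (\<Sum>(v, h)\<in>configurations k a n (Suc R) s s'. \<Prod>i\<in>{1..Suc R}. ?wt v h i)"
  \<comment> \<open>Gluing extends \<open>v\<close> by \<open>s'\<close> and \<open>h\<close> by
    \<open>g\<close> in row \<open>Suc R\<close>; cutting restricts both and reads \<open>u\<close>
    off the vertical edges above row \<open>R\<close>.\<close>
  proof (rule sum.reindex_bij_witness[where
        j = "\<lambda>(u, (v, h), g). (?ext_v v, ?ext_h g h)" and
        i = "\<lambda>(v, h). (\<lambda>c\<in>?C. v (R, c), (restrict v ({0..R} \<times> ?C), restrict h ({1..R} \<times> ?D)), \<lambda>c\<in>?D. h (Suc R, c))"],
      goal_cases)
    case (1 p)
    then obtain u v h g where p: "p = (u, (v, h), g)" "u \<in> ?X" "(v, h) \<in> configurations k a n R s u" "g \<in> ?G"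
      by (cases p) auto
    have v: "v \<in> {0..R} \<times> ?C \<rightarrow>\<^sub>E labels k" "h \<in> {1..R} \<times> ?D \<rightarrow>\<^sub>E labels k" "\<forall>c\<in>?C. v (R, c) = u c"
      using p(3) unfolding configurations_def by auto
    have "(\<lambda>c\<in>?C. ?ext_v v (R, c)) = u"
      using v(3) by (intro restrict_PiE_eqI[OF p(2)]) auto
    moreover have "restrict (?ext_v v) ({0..R} \<times> ?C) = v"
      by (intro restrict_PiE_eqI[OF v(1)]) auto
    moreover have "restrict (?ext_h g h) ({1..R} \<times> ?D) = h"
      by (intro restrict_PiE_eqI[OF v(2)]) auto
    moreover have "(\<lambda>c\<in>?D. ?ext_h g h (Suc R, c)) = g"
      using p(4) by (intro restrict_PiE_eqI[of g _ "labels k"]) auto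
    ultimately show ?case unfolding p(1) by simp
  next
    case (2 p)
    then obtain u v h g where p: "p = (u, (v, h), g)" "u \<in> ?X" "(v, h) \<in> configurations k a n R s u" "g \<in> ?G"
      by (cases p) auto
    have v: "v \<in> {0..R} \<times> ?C \<rightarrow>\<^sub>E labels k" "h \<in> {1..R} \<times> ?D \<rightarrow>\<^sub>E labels k"
      using p(3) unfolding configurations_def by auto
    have "?ext_v v \<in> {0..Suc R} \<times> ?C \<rightarrow>\<^sub>E labels k"
      using v(1) s' by (auto simp: PiE_iff extensional_def)
    moreover have "?ext_h g h \<in> {1..Suc R} \<times> ?D \<rightarrow>\<^sub>E labels k"
      using v(2) p(4) by (auto simp: PiE_iff extensional_def)
    ultimately show ?case
      using p(3,4) unfolding p(1) configurations_def by auto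
  next
    case (3 p)
    then obtain v h where p: "p = (v, h)" "(v, h) \<in> configurations k a n (Suc R) s s'"
      by (cases p) auto
    have v: "v \<in> {0..Suc R} \<times> ?C \<rightarrow>\<^sub>E labels k" "h \<in> {1..Suc R} \<times> ?D \<rightarrow>\<^sub>E labels k" "\<forall>c\<in>?C. v (Suc R, c) = s' c"
      using p(2) unfolding configurations_def by auto
    have "?ext_v (restrict v ({0..R} \<times> ?C)) = v"
      using v(1,3) by (intro ext) (auto simp: restrict_def PiE_def extensional_def le_Suc_eq)
    moreover have "?ext_h (\<lambda>c\<in>?D. h (Suc R, c)) (restrict h ({1..R} \<times> ?D)) = h"
      using v(2) by (intro ext) (auto simp: restrict_def PiE_def extensional_def le_Suc_eq)
    ultimately show ?case by (simp only: p(1) prod.case)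
  next
    case (4 p)
    then obtain v h where p: "p = (v, h)" "(v, h) \<in> configurations k a n (Suc R) s s'"
      by (cases p) auto
    have v: "v \<in> {0..Suc R} \<times> ?C \<rightarrow>\<^sub>E labels k" "h \<in> {1..Suc R} \<times> ?D \<rightarrow>\<^sub>E labels k"
      using p(2) unfolding configurations_def by auto
    have "(\<lambda>c\<in>?C. v (R, c)) \<in> ?X" using v(1) by (auto simp: PiE_iff)
    moreover have "restrict v ({0..R} \<times> ?C) \<in> {0..R} \<times> ?C \<rightarrow>\<^sub>E labels k"
      using v(1) by (auto simp: PiE_iff)
    moreover have "restrict h ({1..R} \<times> ?D) \<in> {1..R} \<times> ?D \<rightarrow>\<^sub>E labels k"
      using v(2) by (auto simp: PiE_iff)
    moreover have "(\<lambda>c\<in>?D. h (Suc R, c)) \<in> {a..a + int n} \<rightarrow>\<^sub>E labels k"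
      using v(2) by (auto simp: PiE_iff)
    ultimately show ?case using p(2) unfolding p(1) configurations_def by auto
  next
    case (5 p)
    then obtain u v h g where p: "p = (u, (v, h), g)" "u \<in> ?X" "(v, h) \<in> configurations k a n R s u" "g \<in> ?G"
      by (cases p) auto
    have u: "v (R, c) = u c" if "c \<in> ?C" for c using that p(3) unfolding configurations_def by auto
    have "(\<Prod>i\<in>{1..R}. ?wt (?ext_v v) (?ext_h g h) i) = (\<Prod>i\<in>{1..R}. ?wt v h i)"
      by (intro prod.cong refl) auto
    moreover have "?wt (?ext_v v) (?ext_h g h) (Suc R) = (\<Prod>c\<in>?C. w (Suc R) (u c) (g c) (s' c) (g (c + 1)))"
      by (intro prod.cong refl) (auto simp: u)
    ultimately show ?case unfolding p(1) by (simp add: mult.commute)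
  qed
  finally show ?thesis unfolding partition_function_def ..
qed

section \<open>Commuting row operators\<close>

text \<open>The row vector \<open>r\<close> times the matrix \<open>T\<close>. The value 0 outside
  \<open>X\<close> turns identities of operators into equalities of functions.\<close>

definition act :: "'s set \<Rightarrow> ('s \<Rightarrow> 's \<Rightarrow> 'a::comm_ring_1) \<Rightarrow> ('s \<Rightarrow> 'a) \<Rightarrow> 's \<Rightarrow> 'a" where
  "act X T r = (\<lambda>s'. if s' \<in> X then \<Sum>u\<in>X. r u * T u s' else 0)"

lemma act_act: "act X B (act X A r) = act X (\<lambda>v s'. \<Sum>u\<in>X. A v u * B u s') r"
proof (rule ext)
  fix s'
  have "(\<Sum>u\<in>X. (\<Sum>v\<in>X. r v * A v u) * B u s') = (\<Sum>v\<in>X. r v * (\<Sum>u\<in>X. A v u * B u s'))"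
    unfolding sum_distrib_left sum_distrib_right by (subst sum.swap) (simp add: mult.assoc)
  then show "act X B (act X A r) s' = act X (\<lambda>v s'. \<Sum>u\<in>X. A v u * B u s') r s'"
    unfolding act_def by simp
qed

lemma act_cong:
  "(\<And>u s'. u \<in> X \<Longrightarrow> s' \<in> X \<Longrightarrow> A u s' = B u s') \<Longrightarrow> act X A r = act X B r"
  unfolding act_def by (intro ext) simp

lemma act_restrict: "act X T (\<lambda>s. if s \<in> X then r s else 0) = act X T r"
  unfolding act_def by (intro ext) simp

lemma restrict_act: "(\<lambda>s. if s \<in> X then act X T r s else 0) = act X T r"
  unfolding act_def by (intro ext) simp

text \<open>\<open>fold\<close> applies the head of the list first, so the list names the rows from
  bottom to top.\<close>

lemma partition_function_eq_fold:
  fixes w :: "nat \<Rightarrow> 'a::comm_ring_1 vertex_weight"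
  assumes "s \<in> states k a n" "s' \<in> states k a n"
  shows "partition_function k a n w R s s' =
    fold (act (states k a n)) (map (\<lambda>i. transfer k a n (w i)) [1..<Suc R]) (\<lambda>u. if u = s then 1 else 0) s'"
  using assms(2)
proof (induction R arbitrary: s')
  case 0
  then show ?case using assms(1) by (simp add: partition_function_0)
next
  case (Suc R)
  then show ?case
    by (simp add: partition_function_Suc act_def)
qed

context
  fixes k :: nat and a :: int and n :: nat and t :: "'a::comm_ring_1"
begin

abbreviation "white x \<equiv> act (states k a n) (transfer k a n (white_weight k t x))"
abbreviation "purple y \<equiv> act (states k a n) (transfer k a n (purple_weight k t y))"

text \<open>The operator applied first is the lower row, so the left side has purple below
  white.\<close>

lemma white_purple_commute: "white x (purple y r) = purple y (white x r)"
proof -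
  have "(\<Sum>u\<in>states k a n. transfer k a n (purple_weight k t y) v u * transfer k a n (white_weight k t x) u s')
      = (\<Sum>u\<in>states k a n. transfer k a n (white_weight k t x) v u * transfer k a n (purple_weight k t y) u s')"
    if "v \<in> states k a n" "s' \<in> states k a n" for v s'
    unfolding transfer_def sum_row_row
    by (rule two_rows_commute [symmetric]) (use that in auto)
  then show ?thesis unfolding act_act by (intro act_cong)
qed

text \<open>By \<open>two_rows_pw_cancel\<close> the matrix product is the identity; the restriction
  appears because \<open>act\<close> discards values outside the states.\<close>

lemma white_purple_cancel: "white x (purple (- x) r) = (\<lambda>s. if s \<in> states k a n then r s else 0)"
proof -
  have "(\<Sum>u\<in>states k a n. transfer k a n (purple_weight k t (- x)) v u * transfer k a n (white_weight k t x) u s')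
      = (if v = s' then 1 else 0)" if vs: "v \<in> states k a n" "s' \<in> states k a n" for v s'
  proof -
    have "v = s'" if eq: "\<forall>i<n. v (a + int i) = s' (a + int i)"
    proof (rule PiE_ext[OF vs])
      fix c assume "c \<in> {a..<a + int n}"
      then have "c = a + int (nat (c - a))" "nat (c - a) < n" by auto
      then show "v c = s' c" using eq by metis
    qed
    then have "(\<forall>i<n. v (a + int i) = s' (a + int i)) \<longleftrightarrow> v = s'" by blast
    then show ?thesis
      unfolding transfer_def sum_row_row
      by (subst two_rows_pw_cancel) (use vs in auto)
  qed
  then have "white x (purple (- x) r) = act (states k a n) (\<lambda>v s'. if v = s' then 1 else 0) r"
    unfolding act_act by (intro act_cong)
  also have "\<dots> = (\<lambda>s. if s \<in> states k a n then r s else 0)"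
    unfolding act_def using finite_states[of a n k] by (intro ext) (simp add: if_distrib cong: if_cong)
  finally show ?thesis .
qed

text \<open>The pair \<open>white x\<close>, \<open>purple (- x)\<close> is inserted next to
  \<open>r\<close>; the purple row then moves past \<open>white z\<close> and cancels against the
  outer \<open>white x\<close>.\<close>

lemma white_commute: "white x (white z r) = white z (white x r)"
proof -
  have "white x (white z r) = white x (white z (white x (purple (- x) r)))"
    by (simp add: white_purple_cancel act_restrict)
  also have "\<dots> = white x (white z (purple (- x) (white x r)))" by (simp add: white_purple_commute)
  also have "\<dots> = white x (purple (- x) (white z (white x r)))" by (simp add: white_purple_commute)
  also have "\<dots> = white z (white x r)" by (simp only: white_purple_cancel restrict_act)
  finally show ?thesis .
qed

lemma purple_commute: "purple y (purple z r) = purple z (purple y r)"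
proof -
  \<comment> \<open>Here \<open>white (- y)\<close> is the inverse, because the parameter opposite
    to \<open>- y\<close> is \<open>y\<close>.\<close>
  have cancel: "white (- y) (purple y r) = (\<lambda>s. if s \<in> states k a n then r s else 0)" for r
    using white_purple_cancel[of "- y"] by simp
  have "purple y (purple z r) = purple y (purple z (white (- y) (purple y r)))"
    by (simp add: cancel act_restrict)
  also have "\<dots> = purple y (white (- y) (purple z (purple y r)))" by (simp only: white_purple_commute)
  also have "\<dots> = white (- y) (purple y (purple z (purple y r)))" by (simp only: white_purple_commute)
  also have "\<dots> = purple z (purple y r)" by (simp only: cancel restrict_act)
  finally show ?thesis .
qed

lemma act_transfer_commute:
  assumes "A \<in> range (\<lambda>x. transfer k a n (white_weight k t x)) \<union> range (\<lambda>y. transfer k a n (purple_weight k t y))"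
    "B \<in> range (\<lambda>x. transfer k a n (white_weight k t x)) \<union> range (\<lambda>y. transfer k a n (purple_weight k t y))"
  shows "act (states k a n) A \<circ> act (states k a n) B = act (states k a n) B \<circ> act (states k a n) A"
  using assms by (auto simp: fun_eq_iff white_purple_commute white_commute purple_commute)

end

text \<open>The rows become a word in transfer matrices, applied to the indicator of the bottom
  state and evaluated at the top state. The assumption on \<open>N\<close> fixes the number of
  columns as \<open>n\<close>.\<close>

lemma super_LLT_eq_fold:
  fixes t :: "'a::comm_ring_1" and k :: nat
  assumes N: "N + 1 = - int ell + int n"
  defines "X \<equiv> states k (- int ell) n"
  shows "super_LLT k ell N lam mu t p q x y =
    fold (act X)
      (map (\<lambda>i. transfer k (- int ell) n (white_weight k t (x i))) [1..<Suc p] @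
       map (\<lambda>i. transfer k (- int ell) n (purple_weight k t (y i))) [1..<Suc q])
      (\<lambda>u. if u = restrict (boundary_label k ell mu) {- int ell..N} then 1 else 0)
      (restrict (boundary_label k ell lam) {- int ell..N})"
proof -
  let ?a = "- int ell"
  let ?s = "\<lambda>lam. restrict (boundary_label k ell lam) {?a..N}"
  let ?w = "\<lambda>i. if i \<le> p then white_weight k t (x i) else purple_weight k t (y (i - p))"
  have C: "{?a..N} = {?a..<?a + int n}" using N by auto
  have X: "?s lam \<in> X" for lam
    unfolding X_def C by (auto simp: labels_def boundary_label_def)
  have "configs k ell N (p + q) lam mu = configurations k ?a n (p + q) (?s mu) (?s lam)"
    unfolding configs_def configurations_def C N by auto
  then have "super_LLT k ell N lam mu t p q x y = partition_function k ?a n ?w (p + q) (?s mu) (?s lam)"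
    unfolding super_LLT_def partition_function_def C
    by (intro sum.cong refl) (auto intro!: prod.cong)
  also have "\<dots> = fold (act X) (map (\<lambda>i. transfer k ?a n (?w i)) [1..<Suc (p + q)])
      (\<lambda>u. if u = ?s mu then 1 else 0) (?s lam)"
    unfolding X_def by (intro partition_function_eq_fold X[unfolded X_def])
  also have "map (\<lambda>i. transfer k ?a n (?w i)) [1..<Suc (p + q)] =
      map (\<lambda>i. transfer k ?a n (white_weight k t (x i))) [1..<Suc p] @
      map (\<lambda>i. transfer k ?a n (purple_weight k t (y i))) [1..<Suc q]"
    by (rule nth_equalityI) (auto simp: nth_append Suc_diff_le simp del: upt_Suc)
  finally show ?thesis .
qed

lemma mset_map_permutes:
  assumes "\<pi> permutes {1..n}"
  shows "mset (map (\<lambda>i. f (\<pi> i)) [1..<Suc n]) = mset (map f [1..<Suc n])"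
proof -
  have set: "mset [1..<Suc n] = mset_set {1..n}"
    by (simp add: atLeastLessThanSuc_atLeastAtMost del: upt_Suc)
  have "image_mset \<pi> (mset_set {1..n}) = mset_set {1..n}"
    using assms by (simp add: image_mset_mset_set permutes_inj_on permutes_image)
  then show ?thesis
    unfolding mset_map set by (metis (no_types, lifting) comp_apply image_mset.compositionality image_mset_cong)
qed

theorem theorem4p7:
  fixes k ell :: nat and N :: int
    and lam mu :: "nat \<Rightarrow> nat \<Rightarrow> nat"
    and t :: "'a::comm_ring_1"
  assumes "k \<ge> 1"
    and "\<forall>a\<in>{1..k}. is_partition (lam a)"
    and "\<forall>a\<in>{1..k}. is_partition (mu a)"
    and "lattice_fits k ell N lam"
    and "lattice_fits k ell N mu"
  shows "supersymmetric (super_LLT k ell N lam mu t)"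
proof -
  \<comment> \<open>Colour 1 exists, and its first part is at least 0, so
    \<open>N + 1 \<ge> 0\<close> and the \<open>nat\<close> below truncates nothing.\<close>
  have "int (lam 1 1) - 1 \<le> N" using assms(1,4) unfolding lattice_fits_def by auto
  then have N: "N + 1 = - int ell + int (nat (N + 1 + int ell))" by simp
  define n where "n = nat (N + 1 + int ell)"
  define X where "X = states k (- int ell) n"
  define W where "W x = transfer k (- int ell) n (white_weight k t x)" for x
  define P where "P y = transfer k (- int ell) n (purple_weight k t y)" for y
  define b where "b = (\<lambda>u. if u = restrict (boundary_label k ell mu) {- int ell..N} then 1 else 0 :: 'a)"
  have LLT: "super_LLT k ell N lam mu t p q x y =
      fold (act X) (map (\<lambda>i. W (x i)) [1..<Suc p] @ map (\<lambda>i. P (y i)) [1..<Suc q]) b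
        (restrict (boundary_label k ell lam) {- int ell..N})" for p q x y
    unfolding X_def W_def P_def b_def n_def by (rule super_LLT_eq_fold[OF N])
  have fold_eq: "fold (act X) As = fold (act X) Bs"
    if "set As \<subseteq> range W \<union> range P" "mset As = mset Bs" for As Bs
  proof (rule fold_multiset_equiv[OF _ that(2)])
    fix A B assume "A \<in> set As" "B \<in> set As"
    then show "act X A \<circ> act X B = act X B \<circ> act X A"
      using that(1) unfolding X_def W_def P_def by (intro act_transfer_commute[of _ k _ n t]) auto
  qed
  \<comment> \<open>The vector \<open>b\<close> is supported on states, so the restriction in
    \<open>white_purple_cancel\<close> leaves it unchanged.\<close>
  have b: "act X (W r) (act X (P (- r)) b) = b" for r
  proof -
    have "{- int ell..N} = {- int ell..<- int ell + int n}" using N unfolding n_def by auto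
    then have "restrict (boundary_label k ell mu) {- int ell..N} \<in> X"
      unfolding X_def by (auto simp: labels_def boundary_label_def)
    then show ?thesis
      unfolding X_def W_def P_def white_purple_cancel b_def by auto
  qed
  show ?thesis
    unfolding supersymmetric_def LLT
  proof (intro conjI allI impI)
    fix p q :: nat and x y :: "nat \<Rightarrow> 'a" and \<pi> assume "\<pi> permutes {1..p}"
    then have "fold (act X) (map (\<lambda>i. W ((x \<circ> \<pi>) i)) [1..<Suc p] @ map (\<lambda>i. P (y i)) [1..<Suc q])
      = fold (act X) (map (\<lambda>i. W (x i)) [1..<Suc p] @ map (\<lambda>i. P (y i)) [1..<Suc q])"
      using mset_map_permutes[of \<pi> p "\<lambda>i. W (x i)"] by (intro fold_eq) (auto simp del: upt_Suc mset_map)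
    then show "fold (act X) (map (\<lambda>i. W ((x \<circ> \<pi>) i)) [1..<Suc p] @ map (\<lambda>i. P (y i)) [1..<Suc q]) b
        (restrict (boundary_label k ell lam) {- int ell..N})
      = fold (act X) (map (\<lambda>i. W (x i)) [1..<Suc p] @ map (\<lambda>i. P (y i)) [1..<Suc q]) b
        (restrict (boundary_label k ell lam) {- int ell..N})"
      by (simp only:)
  next
    fix p q :: nat and x y :: "nat \<Rightarrow> 'a" and \<pi> assume "\<pi> permutes {1..q}"
    then have "fold (act X) (map (\<lambda>i. W (x i)) [1..<Suc p] @ map (\<lambda>i. P ((y \<circ> \<pi>) i)) [1..<Suc q])
      = fold (act X) (map (\<lambda>i. W (x i)) [1..<Suc p] @ map (\<lambda>i. P (y i)) [1..<Suc q])"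
      using mset_map_permutes[of \<pi> q "\<lambda>i. P (y i)"] by (intro fold_eq) (auto simp del: upt_Suc mset_map)
    then show "fold (act X) (map (\<lambda>i. W (x i)) [1..<Suc p] @ map (\<lambda>i. P ((y \<circ> \<pi>) i)) [1..<Suc q]) b
        (restrict (boundary_label k ell lam) {- int ell..N})
      = fold (act X) (map (\<lambda>i. W (x i)) [1..<Suc p] @ map (\<lambda>i. P (y i)) [1..<Suc q]) b
        (restrict (boundary_label k ell lam) {- int ell..N})"
      by (simp only:)
  next
    fix p q :: nat and x y :: "nat \<Rightarrow> 'a" and r assume "1 \<le> p" "1 \<le> q"
    then obtain p' q' where [simp]: "p = Suc p'" "q = Suc q'" by (metis Suc_le_D One_nat_def)
    let ?As = "map (\<lambda>i. W ((x(p := r)) i)) [1..<Suc p] @ map (\<lambda>i. P ((y(q := - r)) i)) [1..<Suc q]"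
    let ?Bs = "map (\<lambda>i. W (x i)) [1..<Suc p'] @ map (\<lambda>i. P (y i)) [1..<Suc q']"
    have snoc: "map (\<lambda>i. W ((x(p := r)) i)) [1..<Suc p] = map (\<lambda>i. W (x i)) [1..<Suc p'] @ [W r]"
      "map (\<lambda>i. P ((y(q := - r)) i)) [1..<Suc q] = map (\<lambda>i. P (y i)) [1..<Suc q'] @ [P (- r)]"
      by auto
    \<comment> \<open>The rows with parameters \<open>r\<close> and \<open>- r\<close> move to the
      bottom, purple first, where the pair fixes \<open>b\<close>.\<close>
    have "mset ?As = mset (P (- r) # W r # ?Bs)"
      unfolding snoc by (simp del: upt_Suc)
    then have "fold (act X) ?As = fold (act X) (P (- r) # W r # ?Bs)"
      by (intro fold_eq) auto
    then show "fold (act X) ?As b (restrict (boundary_label k ell lam) {- int ell..N})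
      = fold (act X) (map (\<lambda>i. W (x i)) [1..<Suc (p - 1)] @ map (\<lambda>i. P (y i)) [1..<Suc (q - 1)]) b
        (restrict (boundary_label k ell lam) {- int ell..N})"
      by (simp add: b del: upt_Suc)
  qed
qed

end
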